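(* Let $\mathcal D=(\mathcal D(n))_n\subseteq\mathbb S^2$ be the spin disk $$\mathcal D(n)=\Big\{(X_1,X_2)\in\mathbb S_n^2:\begin{pmatrix} I+X_1 & X_2 \\ X_2 & I-X_1 \end{pmatrix}\succeq0\Big\}.$$ A pair $(X_1,X_2)\in\mathbb S^2$ is in the Arveson boundary $\partial^{\rm arv}\mathcal D$ of $\mathcal D$ if and only if $X_1$ and $X_2$ commute and $I-X_1^2-X_2^2=0$. Furthermore, $\operatorname{co}^{\mathrm{mat}}(\partial^{\rm arv}\mathcal D)=\mathcal D$. Consequently, the set of absolute extreme points of $\mathcal D$ equals the set of Euclidean extreme points of $\mathcal D(1)$.
   Context: $\mathbb S_n^g$ is the set of $g$-tuples of complex self-adjoint $n\times n$ matrices, $\mathbb S^g=(\mathbb S_n^g)_n$ (here $g=2$). Operations on tuples are coordinatewise; $A\sim B$ denotes unitary equivalence of tuples. A set $K=(K(n))_n$ is matrix convex if it is closed under direct sums and $V^*XV\in K(m)$ whenever $m\le n$, $X\in K(n)$, $V:\mathbb C^m\to\mathbb C^n$ an isometry; $\operatorname{co}^{\mathrm{mat}}(\Gamma)$ is the smallest matrix convex set containing $\Gamma$. $X\in K(n)$ is in the Arveson boundary $\partial^{\rm arv}K$ if for every $m\ge1$, every $g$-tuple $\alpha$ of $n\times m$ matrices and $\beta\in\mathbb S_m^g$, $\begin{pmatrix} X & \alpha \\ \alpha^* & \beta \end{pmatrix}\in K(n+m)$ implies $\alpha=0$. $X\in K(n)$ is an absolute extreme point of $K$ if whenever $X=\sum_{\ell=1}^N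 V_\ell^*Y^\ell V_\ell$, $\sum_\ell V_\ell^*V_\ell=I_n$ with $Y^\ell\in K(n_\ell)$ and all $V_\ell:\mathbb C^n\to\mathbb C^{n_\ell}$ nonzero, then for each $\ell$ either $n_\ell\le n$ and $X\sim Y^\ell$, or $n_\ell>n$ and $Y^\ell\sim X\oplus Z^\ell$ for some $Z^\ell\in K$. Euclidean extreme point of $\mathcal D(1)\subseteq\mathbb R^2$ means extreme point in the usual sense. *)

theory Defs
  imports "HOL-Analysis.Polytope" "Jordan_Normal_Form.Schur_Decomposition"
begin

text \<open>
  A graded set \<open>(K(n))\<^sub>n\<close> of pairs of matrices is a function on \<^typ>\<open>nat\<close>. The levels of the
  mathematics start at \<open>n = 1\<close>, whereas matrices of dimension \<open>0\<close> exist in the library; they are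
  excluded by making level \<open>0\<close> of the ambient space \<open>hermitian_pairs\<close> empty.
\<close>

type_synonym cpair = "complex mat \<times> complex mat"

definition hermitian_pairs :: "nat \<Rightarrow> cpair set" where
  "hermitian_pairs n = {(A, B). 0 < n \<and> A \<in> carrier_mat n n \<and> B \<in> carrier_mat n n \<and>
     mat_adjoint A = A \<and> mat_adjoint B = B}"

text \<open>In the order on \<^typ>\<open>complex\<close>, \<open>0 \<le> z\<close> means that \<open>z\<close> is real and nonnegative.\<close>

definition psd_mat :: "nat \<Rightarrow> complex mat \<Rightarrow> bool" where
  "psd_mat n A \<longleftrightarrow> A \<in> carrier_mat n n \<and> mat_adjoint A = A \<and>
     (\<forall>v \<in> carrier_vec n. 0 \<le> scalar_prod (A *\<^sub>v v) (conjugate v))"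

text \<open>\<open>isometry_mat n m V\<close>: \<open>V\<close> is an isometry from \<open>\<complex>\<^sup>m\<close> to \<open>\<complex>\<^sup>n\<close>.\<close>

definition isometry_mat :: "nat \<Rightarrow> nat \<Rightarrow> complex mat \<Rightarrow> bool" where
  "isometry_mat n m V \<longleftrightarrow> V \<in> carrier_mat n m \<and> mat_adjoint V * V = 1\<^sub>m m"

definition unitary_mat :: "nat \<Rightarrow> complex mat \<Rightarrow> bool" where
  "unitary_mat n U \<longleftrightarrow> U \<in> carrier_mat n n \<and>
     mat_adjoint U * U = 1\<^sub>m n \<and> U * mat_adjoint U = 1\<^sub>m n"

definition compress :: "complex mat \<Rightarrow> cpair \<Rightarrow> cpair" where
  "compress V X = (mat_adjoint V * fst X * V, mat_adjoint V * snd X * V)"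

definition unitarily_equiv :: "nat \<Rightarrow> cpair \<Rightarrow> cpair \<Rightarrow> bool" where
  "unitarily_equiv n X Y \<longleftrightarrow> X \<in> hermitian_pairs n \<and> Y \<in> hermitian_pairs n \<and>
     (\<exists>U. unitary_mat n U \<and> Y = compress U X)"

text \<open>\<open>block_pair X \<alpha> \<beta>\<close> is \<open>((X, \<alpha>), (\<alpha>\<^sup>*, \<beta>))\<close>, formed in each of the two coordinates.\<close>

definition block_pair :: "cpair \<Rightarrow> cpair \<Rightarrow> cpair \<Rightarrow> cpair" where
  "block_pair X \<alpha> \<beta> =
     (four_block_mat (fst X) (fst \<alpha>) (mat_adjoint (fst \<alpha>)) (fst \<beta>),
      four_block_mat (snd X) (snd \<alpha>) (mat_adjoint (snd \<alpha>)) (snd \<beta>))"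

definition direct_sum_pair :: "nat \<Rightarrow> nat \<Rightarrow> cpair \<Rightarrow> cpair \<Rightarrow> cpair" where
  "direct_sum_pair n m X Y =
     (four_block_mat (fst X) (0\<^sub>m n m) (0\<^sub>m m n) (fst Y),
      four_block_mat (snd X) (0\<^sub>m n m) (0\<^sub>m m n) (snd Y))"

definition matrix_convex :: "(nat \<Rightarrow> cpair set) \<Rightarrow> bool" where
  "matrix_convex K \<longleftrightarrow>
     (\<forall>n. K n \<subseteq> hermitian_pairs n) \<and>
     (\<forall>n m. \<forall>X \<in> K n. \<forall>Y \<in> K m. direct_sum_pair n m X Y \<in> K (n + m)) \<and>
     (\<forall>n m V. \<forall>X \<in> K n. 1 \<le> m \<and> m \<le> n \<and> isometry_mat n m V \<longrightarrow> compress V X \<in> K m)"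

text \<open>Inclusion and infimum of graded sets are the levelwise ones.\<close>

definition matrix_convex_hull :: "(nat \<Rightarrow> cpair set) \<Rightarrow> nat \<Rightarrow> cpair set" where
  "matrix_convex_hull \<Gamma> = Inf {K. matrix_convex K \<and> \<Gamma> \<le> K}"

lemma matrix_convex_hull_superset: "\<Gamma> \<le> matrix_convex_hull \<Gamma>"
  unfolding matrix_convex_hull_def by (rule Inf_greatest) blast

lemma matrix_convex_hull_least:
  assumes "matrix_convex K" "\<Gamma> \<le> K"
  shows "matrix_convex_hull \<Gamma> \<le> K"
  unfolding matrix_convex_hull_def by (rule Inf_lower) (use assms in blast)

lemma matrix_convex_matrix_convex_hull:
  assumes "matrix_convex K" "\<Gamma> \<le> K"
  shows "matrix_convex (matrix_convex_hull \<Gamma>)"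
proof -
  have mem: "X \<in> matrix_convex_hull \<Gamma> n \<longleftrightarrow> (\<forall>L. matrix_convex L \<and> \<Gamma> \<le> L \<longrightarrow> X \<in> L n)" for X n
    unfolding matrix_convex_hull_def by auto
  have "matrix_convex_hull \<Gamma> n \<subseteq> hermitian_pairs n" for n
    using assms matrix_convex_hull_least[OF assms] unfolding matrix_convex_def le_fun_def by blast
  moreover have "direct_sum_pair n m X Y \<in> matrix_convex_hull \<Gamma> (n + m)"
    if "X \<in> matrix_convex_hull \<Gamma> n" "Y \<in> matrix_convex_hull \<Gamma> m" for n m X Y
    using that unfolding mem by (auto simp: matrix_convex_def)
  moreover have "compress V X \<in> matrix_convex_hull \<Gamma> m"
    if "X \<in> matrix_convex_hull \<Gamma> n" "1 \<le> m" "m \<le> n" "isometry_mat n m V" for n m X V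
    using that unfolding mem by (auto simp: matrix_convex_def)
  ultimately show ?thesis
    unfolding matrix_convex_def by blast
qed

definition arveson_boundary :: "(nat \<Rightarrow> cpair set) \<Rightarrow> nat \<Rightarrow> cpair set" where
  "arveson_boundary K n = {X \<in> K n. \<forall>m \<ge> 1. \<forall>\<alpha> \<in> carrier_mat n m \<times> carrier_mat n m.
     \<forall>\<beta> \<in> hermitian_pairs m. block_pair X \<alpha> \<beta> \<in> K (n + m) \<longrightarrow> \<alpha> = (0\<^sub>m n m, 0\<^sub>m n m)}"

text \<open>
  \<open>mat_sum n F N\<close> is the sum of the \<open>n \<times> n\<close> matrices \<open>F l\<close> for \<open>l < N\<close>: matrices of varying
  dimension form no additive monoid, so the generic sum does not apply.
\<close>

definition mat_sum :: "nat \<Rightarrow> (nat \<Rightarrow> complex mat) \<Rightarrow> nat \<Rightarrow> complex mat" where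
  "mat_sum n F N = mat n n (\<lambda>ij. \<Sum>l<N. F l $$ ij)"

text \<open>
  \<open>unitarily_equiv n\<close> requires both pairs to be at level \<open>n\<close>, so the first alternative below forces
  \<open>k l = n\<close>. The bound \<open>0 < N\<close> is implied by the sum being \<open>1\<^sub>m n\<close> with \<open>0 < n\<close>.
\<close>

definition absolute_extreme_points :: "(nat \<Rightarrow> cpair set) \<Rightarrow> nat \<Rightarrow> cpair set" where
  "absolute_extreme_points K n = {X \<in> K n.
     \<forall>N (k :: nat \<Rightarrow> nat) (Y :: nat \<Rightarrow> cpair) (V :: nat \<Rightarrow> complex mat).
       (\<forall>l<N. Y l \<in> K (k l) \<and> V l \<in> carrier_mat (k l) n \<and> V l \<noteq> 0\<^sub>m (k l) n) \<and>
       mat_sum n (\<lambda>l. mat_adjoint (V l) * V l) N = 1\<^sub>m n \<and>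
       X = (mat_sum n (\<lambda>l. fst (compress (V l) (Y l))) N,
            mat_sum n (\<lambda>l. snd (compress (V l) (Y l))) N) \<longrightarrow>
       (\<forall>l<N. (k l \<le> n \<and> unitarily_equiv n X (Y l)) \<or>
              (n < k l \<and> (\<exists>Z \<in> K (k l - n).
                 unitarily_equiv (k l) (Y l) (direct_sum_pair n (k l - n) X Z))))}"

definition spin_disk :: "nat \<Rightarrow> cpair set" where
  "spin_disk n = {(X1, X2) \<in> hermitian_pairs n.
     psd_mat (n + n) (four_block_mat (1\<^sub>m n + X1) X2 X2 (1\<^sub>m n - X1))}"

text \<open>The identification of \<open>\<real>\<^sup>2\<close> with the pairs of self-adjoint \<open>1 \<times> 1\<close> matrices.\<close>

definition scalar_pair :: "real \<times> real \<Rightarrow> cpair" where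
  "scalar_pair p = (mat 1 1 (\<lambda>_. complex_of_real (fst p)), mat 1 1 (\<lambda>_. complex_of_real (snd p)))"

definition level_one :: "(nat \<Rightarrow> cpair set) \<Rightarrow> (real \<times> real) set" where
  "level_one K = {p. scalar_pair p \<in> K 1}"

end

theory Submission
  imports Defs "Jordan_Normal_Form.Spectral_Radius"
begin

text \<open>
  Put \<open>A = X\<^sub>1 + \<i> X\<^sub>2\<close>. A unitary change of variables turns the defining matrix of the spin disk into
  \<open>((I, A\<^sup>*), (A, I))\<close>, so \<open>\<D>\<close> is the set of contractions, and \<open>A\<close> is unitary if and only if \<open>X\<^sub>1\<close> and
  \<open>X\<^sub>2\<close> commute and \<open>X\<^sub>1\<^sup>2 + X\<^sub>2\<^sup>2 = I\<close>. A contraction extending a unitary is a direct sum, while to a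
  nonunitary \<open>A\<close> one can add a row bounded by the defect \<open>I - A\<^sup>* A\<close>; hence the Arveson boundary is the
  set of unitaries. Factoring \<open>I - A\<^sup>* A = C\<^sup>* C\<close> and extending the isometry \<open>(A, C)\<close> to a unitary shows
  that \<open>A\<close> is a compression of a unitary. An absolute extreme point is then a direct summand of a
  unitary, and splitting off an eigenvector forces dimension one. Conversely a point \<open>a\<close> of the circle
  is a weighted mean of numbers \<open>\<langle>B v, v\<rangle>\<close> only if every \<open>v\<close> is an eigenvector, for \<open>a\<close>, that reduces
  the contraction \<open>B\<close>.
\<close>

text \<open>For an extension of X by \<alpha> = (\<alpha>1, \<alpha>2), the two off-diagonal blocks
  of the resulting operator, \<alpha>1 + i \<alpha>2 and \<alpha>1* + i \<alpha>2*, are independent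
  of each other. Proving \<alpha> = 0 therefore takes two applications of the contraction argument,
  the second to the adjoint; in return a single new row already comes from some \<alpha>.
  Commutation enters because A* A and A A* equal X1^2 + X2^2 plus and minus i times the commutator
  of X1 and X2. The dilation prescribes only the first block column of the unitary, so any factor C
  of the defect will do in place of its positive square root, and elimination supplies one. The
  absolute extreme property is used twice. The dilation has size 2n > n, so exhibiting X as its
  corner, a combination with one term, forces the dilation to be equivalent to a direct sum of X and
  some Z. Once X is known to be unitary, an eigenvector reduces it, and its eigenvalue is a point of
  the disk that can be split off as one of two terms; the property then makes X equivalent to that 1
  by 1 point.\<close>

unbundle no vec_syntax

section \<open>Adjoints and the Hermitian inner product\<close>

lemma dim_mat_adjoint [simp]:
  "dim_row (mat_adjoint A) = dim_col A" "dim_col (mat_adjoint A) = dim_row A"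
  unfolding mat_adjoint_def by auto

lemma mat_adjoint_carrier [simp]: "A \<in> carrier_mat n m \<Longrightarrow> mat_adjoint A \<in> carrier_mat m n"
  by (intro carrier_matI) auto

lemma index_mat_adjoint [simp]:
  fixes A :: "complex mat"
  shows "i < dim_col A \<Longrightarrow> j < dim_row A \<Longrightarrow> mat_adjoint A $$ (i, j) = cnj (A $$ (j, i))"
  unfolding mat_adjoint_def by (simp add: mat_of_rows_index)

lemma mat_adjoint_adjoint [simp]: "mat_adjoint (mat_adjoint A) = (A :: complex mat)"
  by (intro eq_matI) auto

lemma mat_adjoint_one [simp]: "mat_adjoint (1\<^sub>m n :: complex mat) = 1\<^sub>m n"
  by (intro eq_matI) auto

lemma mat_adjoint_zero [simp]: "mat_adjoint (0\<^sub>m n m :: complex mat) = 0\<^sub>m m n"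
  by (intro eq_matI) auto

lemma mat_adjoint_add:
  fixes A :: "complex mat"
  assumes "dim_row A = dim_row B" "dim_col A = dim_col B"
  shows "mat_adjoint (A + B) = mat_adjoint A + mat_adjoint B"
  using assms by (intro eq_matI) auto

lemma mat_adjoint_minus:
  fixes A :: "complex mat"
  assumes "dim_row A = dim_row B" "dim_col A = dim_col B"
  shows "mat_adjoint (A - B) = mat_adjoint A - mat_adjoint B"
  using assms by (intro eq_matI) auto

lemma mat_adjoint_mult:
  fixes A :: "complex mat"
  assumes "dim_col A = dim_row B"
  shows "mat_adjoint (A * B) = mat_adjoint B * mat_adjoint A"
  using assms by (intro eq_matI) (auto simp: scalar_prod_def mult.commute)

lemma mat_adjoint_four_block:
  fixes A :: "complex mat"
  assumes "dim_row B = dim_row A" "dim_col B = dim_col D" "dim_row C = dim_row D" "dim_col C = dim_col A"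
  shows "mat_adjoint (four_block_mat A B C D) =
    four_block_mat (mat_adjoint A) (mat_adjoint C) (mat_adjoint B) (mat_adjoint D)"
  using assms by (intro eq_matI) auto

text \<open>From here to \<open>mult_mat_smult_vec\<close> the laws carry equations between
  dimensions as premises. With carrier premises the dimensions do not occur in the conclusion and
  would need instantiation at each rewrite.\<close>

lemma mult_mat_assoc:
  fixes A :: "complex mat"
  assumes "dim_col A = dim_row B" "dim_col B = dim_row C"
  shows "A * B * C = A * (B * C)"
  by (rule assoc_mult_mat[of _ "dim_row A" "dim_row B" _ "dim_row C" _ "dim_col C"])
    (use assms in auto)

lemma mult_mat_mat_vec:
  fixes A :: "complex mat"
  assumes "dim_col A = dim_row B" "dim_vec v = dim_col B"
  shows "(A * B) *\<^sub>v v = A *\<^sub>v (B *\<^sub>v v)"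
  by (rule assoc_mult_mat_vec[of _ "dim_row A" "dim_row B" _ "dim_col B"])
    (use assms in \<open>auto intro: carrier_vecI\<close>)

lemma mult_mat_add_right:
  fixes A :: "complex mat"
  assumes "dim_col A = dim_row B" "dim_row C = dim_row B" "dim_col C = dim_col B"
  shows "A * (B + C) = A * B + A * C"
  by (rule mult_add_distrib_mat[of _ "dim_row A" "dim_row B" _ "dim_col B"])
    (use assms in auto)

lemma mult_mat_add_left:
  fixes A :: "complex mat"
  assumes "dim_col A = dim_row C" "dim_row A = dim_row B" "dim_col A = dim_col B"
  shows "(A + B) * C = A * C + B * C"
  by (rule add_mult_distrib_mat[of _ "dim_row A" "dim_col A" _ _ "dim_col C"])
    (use assms in auto)

lemma mult_mat_smult:
  fixes A :: "complex mat"
  assumes "dim_col A = dim_row B"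
  shows "A * (c \<cdot>\<^sub>m B) = c \<cdot>\<^sub>m (A * B)" "(c \<cdot>\<^sub>m A) * B = c \<cdot>\<^sub>m (A * B)"
proof -
  have "A \<in> carrier_mat (dim_row A) (dim_row B)" "B \<in> carrier_mat (dim_row B) (dim_col B)"
    using assms by auto
  then show "A * (c \<cdot>\<^sub>m B) = c \<cdot>\<^sub>m (A * B)" "(c \<cdot>\<^sub>m A) * B = c \<cdot>\<^sub>m (A * B)"
    by (fact mult_smult_distrib mult_smult_assoc_mat)+
qed

lemma smult_mat_mult_vec:
  fixes A :: "complex mat"
  shows "dim_vec v = dim_col A \<Longrightarrow> (c \<cdot>\<^sub>m A) *\<^sub>v v = c \<cdot>\<^sub>v (A *\<^sub>v v)"
  by (intro eq_vecI) auto

lemma add_mat_mult_vec: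
  fixes A :: "complex mat"
  assumes "dim_row A = dim_row B" "dim_col A = dim_col B" "dim_vec v = dim_col B"
  shows "(A + B) *\<^sub>v v = A *\<^sub>v v + B *\<^sub>v v"
  by (rule add_mult_distrib_mat_vec[of _ "dim_row B" "dim_col B"])
    (rule carrier_matI carrier_vecI; simp add: assms)+

lemma minus_mat_mult_vec:
  fixes A :: "complex mat"
  assumes "dim_row A = dim_row B" "dim_col A = dim_col B" "dim_vec v = dim_col B"
  shows "(A - B) *\<^sub>v v = A *\<^sub>v v - B *\<^sub>v v"
  by (rule minus_mult_distrib_mat_vec[of _ "dim_row B" "dim_col B"])
    (rule carrier_matI carrier_vecI; simp add: assms)+

lemma mult_mat_add_vec:
  fixes A :: "complex mat"
  assumes "dim_vec v = dim_col A" "dim_vec w = dim_col A"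
  shows "A *\<^sub>v (v + w) = A *\<^sub>v v + A *\<^sub>v w"
  by (rule mult_add_distrib_mat_vec[of _ "dim_row A" "dim_col A"])
    (rule carrier_matI carrier_vecI; simp add: assms)+

lemma mult_mat_smult_vec:
  fixes A :: "complex mat"
  assumes "dim_vec v = dim_col A"
  shows "A *\<^sub>v (c \<cdot>\<^sub>v v) = c \<cdot>\<^sub>v (A *\<^sub>v v)"
  by (rule mult_mat_vec[of _ "dim_row A" "dim_col A"])
    (rule carrier_matI carrier_vecI; simp add: assms)+

lemmas mult_mat_vec_simps = smult_mat_mult_vec add_mat_mult_vec minus_mat_mult_vec
  mult_mat_add_vec mult_mat_smult_vec mult_mat_mat_vec

lemma zero_mat_mult_vec [simp]:
  fixes v :: "complex vec"
  shows "v \<in> carrier_vec m \<Longrightarrow> 0\<^sub>m n m *\<^sub>v v = 0\<^sub>v n"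
  by (intro eq_vecI) auto

lemma cscalar_prod_add_left:
  fixes v :: "complex vec"
  shows "dim_vec v = dim_vec w \<Longrightarrow> dim_vec u = dim_vec w \<Longrightarrow> (v + u) \<bullet>c w = v \<bullet>c w + u \<bullet>c w"
  by (rule add_scalar_prod_distrib[where n = "dim_vec w"]) (auto intro: carrier_vecI)

lemma cscalar_prod_add_right:
  fixes v :: "complex vec"
  assumes "dim_vec v = dim_vec w" "dim_vec u = dim_vec w"
  shows "v \<bullet>c (w + u) = v \<bullet>c w + v \<bullet>c u"
  using assms by (simp add: scalar_prod_def sum.distrib ring_distribs)

lemma cscalar_prod_minus_left:
  fixes v :: "complex vec"
  shows "dim_vec v = dim_vec w \<Longrightarrow> dim_vec u = dim_vec w \<Longrightarrow> (v - u) \<bullet>c w = v \<bullet>c w - u \<bullet>c w"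
  by (rule minus_scalar_prod_distrib[where n = "dim_vec w"]) (auto intro: carrier_vecI)

lemma cscalar_prod_minus_right:
  fixes v :: "complex vec"
  assumes "dim_vec v = dim_vec w" "dim_vec u = dim_vec w"
  shows "v \<bullet>c (w - u) = v \<bullet>c w - v \<bullet>c u"
  using assms by (simp add: scalar_prod_def sum_subtractf ring_distribs)

lemma cscalar_prod_smult_left:
  fixes v :: "complex vec"
  shows "dim_vec v = dim_vec w \<Longrightarrow> (c \<cdot>\<^sub>v v) \<bullet>c w = c * (v \<bullet>c w)"
  by simp

lemma cscalar_prod_smult_right:
  fixes v :: "complex vec"
  shows "dim_vec v = dim_vec w \<Longrightarrow> v \<bullet>c (c \<cdot>\<^sub>v w) = cnj c * (v \<bullet>c w)"
  by (simp add: conjugate_smult_vec)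

lemmas cscalar_prod_simps = cscalar_prod_add_left cscalar_prod_add_right cscalar_prod_minus_left
  cscalar_prod_minus_right cscalar_prod_smult_left cscalar_prod_smult_right

lemma cscalar_prod_unit_vec:
  fixes v :: "complex vec"
  assumes "k < n"
  shows "v \<bullet>c unit_vec n k = v $ k"
proof -
  have "conjugate (unit_vec n k) = (unit_vec n k :: complex vec)"
    by (intro eq_vecI) (auto simp: unit_vec_def)
  then show ?thesis
    using assms by simp
qed

lemma cnj_cscalar_prod:
  fixes v :: "complex vec"
  assumes "dim_vec v = dim_vec w"
  shows "cnj (v \<bullet>c w) = w \<bullet>c v"
  using assms by (simp add: scalar_prod_def mult.commute)

lemma conjugate_append_vec:
  fixes v w :: "complex vec"
  shows "conjugate (v @\<^sub>v w) = conjugate v @\<^sub>v conjugate w"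
  apply (rule eq_vecI)
   apply (subst vec_index_conjugate, simp)
   apply (subst index_append_vec, simp)
   apply (subst index_append_vec, simp)
   apply simp_all
  done

lemma cscalar_prod_append:
  fixes v :: "complex vec"
  assumes "dim_vec v = dim_vec v'" "dim_vec w = dim_vec w'"
  shows "(v @\<^sub>v w) \<bullet>c (v' @\<^sub>v w') = v \<bullet>c v' + w \<bullet>c w'"
  unfolding conjugate_append_vec
  by (rule scalar_prod_append[of v "dim_vec v'" w "dim_vec w'"]) (rule carrier_vecI, simp add: assms)+

lemma cscalar_prod_mult_mat_vec:
  fixes A :: "complex mat"
  assumes "A \<in> carrier_mat n m" "v \<in> carrier_vec m" "w \<in> carrier_vec n"
  shows "(A *\<^sub>v v) \<bullet>c w = v \<bullet>c (mat_adjoint A *\<^sub>v w)"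
proof -
  have "(A *\<^sub>v v) \<bullet>c w = (\<Sum>i<n. \<Sum>j<m. A $$ (i, j) * v $ j * cnj (w $ i))"
    using assms by (auto simp: scalar_prod_def sum_distrib_right atLeast0LessThan intro!: sum.cong)
  also have "\<dots> = (\<Sum>j<m. \<Sum>i<n. A $$ (i, j) * v $ j * cnj (w $ i))"
    by (rule sum.swap)
  also have "\<dots> = v \<bullet>c (mat_adjoint A *\<^sub>v w)"
    using assms
    apply (simp add: scalar_prod_def sum_distrib_left atLeast0LessThan)
    apply (intro sum.cong)
      apply (simp_all add: mult.assoc mult.left_commute)
    done
  finally show ?thesis .
qed

text \<open>The squared norm is taken real so that estimates use the linear order of the reals
  rather than the partial order on the complex numbers.\<close>

definition vec_sq :: "complex vec \<Rightarrow> real" where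
  "vec_sq v = Re (v \<bullet>c v)"

lemma cscalar_prod_self: "v \<bullet>c v = complex_of_real (vec_sq v)"
proof -
  have "0 \<le> v \<bullet>c v"
    by auto
  then show ?thesis
    unfolding vec_sq_def by (auto simp: less_eq_complex_def complex_eq_iff)
qed

lemma vec_sq_nonneg [simp]: "0 \<le> vec_sq v"
  using conjugate_square_ge_0_vec[of v] by (simp add: vec_sq_def less_eq_complex_def)

lemma vec_sq_eq_0_iff: "v \<in> carrier_vec n \<Longrightarrow> vec_sq v = 0 \<longleftrightarrow> v = 0\<^sub>v n"
  using conjugate_square_eq_0_vec[of v n] by (simp add: cscalar_prod_self)

lemma vec_sq_smult: "vec_sq (c \<cdot>\<^sub>v v) = (cmod c)\<^sup>2 * vec_sq v"
proof -
  have "complex_of_real (vec_sq (c \<cdot>\<^sub>v v)) = complex_of_real ((cmod c)\<^sup>2 * vec_sq v)"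
    by (simp add: cscalar_prod_self[symmetric] cscalar_prod_simps complex_norm_square
        flip: of_real_power)
  then show ?thesis
    using of_real_eq_iff by blast
qed

lemma vec_sq_vec_1: "vec_sq (vec 1 (\<lambda>_. z)) = (cmod z)\<^sup>2"
  unfolding cmod_power2 by (simp add: vec_sq_def scalar_prod_def power2_eq_square)

lemma vec_sq_append: "vec_sq (v @\<^sub>v w) = vec_sq v + vec_sq w"
  by (simp add: vec_sq_def cscalar_prod_append)

lemma vec_sq_add:
  assumes "dim_vec v = dim_vec w"
  shows "vec_sq (v + w) = vec_sq v + vec_sq w + 2 * Re (v \<bullet>c w)"
proof -
  have "Re (w \<bullet>c v) = Re (v \<bullet>c w)"
    using cnj_cscalar_prod[OF assms] by (metis cnj.sel(1))
  then show ?thesis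
    using assms by (simp add: vec_sq_def cscalar_prod_simps)
qed

lemma vec_sq_isometry:
  assumes "isometry_mat n m V" "v \<in> carrier_vec m"
  shows "vec_sq (V *\<^sub>v v) = vec_sq v"
proof -
  have V: "V \<in> carrier_mat n m"
    using assms by (simp add: isometry_mat_def)
  have "(V *\<^sub>v v) \<bullet>c (V *\<^sub>v v) = v \<bullet>c ((mat_adjoint V * V) *\<^sub>v v)"
    using V assms
    by (subst cscalar_prod_mult_mat_vec[of _ n m]) (auto simp: assoc_mult_mat_vec[of _ m n _ m])
  then show ?thesis
    using assms by (simp add: isometry_mat_def vec_sq_def)
qed

text \<open>Testing on unit vectors recovers the columns, hence all entries.\<close>

lemma mat_eqI_mult_mat_vec:
  fixes A :: "complex mat"
  assumes "A \<in> carrier_mat n m" "B \<in> carrier_mat n m"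
    "\<And>v. v \<in> carrier_vec m \<Longrightarrow> A *\<^sub>v v = B *\<^sub>v v"
  shows "A = B"
proof (intro eq_matI)
  fix i j assume ij: "i < dim_row B" "j < dim_col B"
  have "(A *\<^sub>v unit_vec m j) $ i = (B *\<^sub>v unit_vec m j) $ i"
    using assms(3) by simp
  then show "A $$ (i, j) = B $$ (i, j)"
    using ij assms(1,2) by simp
qed (use assms in auto)

section \<open>Pairs of self-adjoint matrices as single operators\<close>

definition to_op :: "cpair \<Rightarrow> complex mat" where
  "to_op X = fst X + \<i> \<cdot>\<^sub>m snd X"

text \<open>The Cartesian decomposition into real and imaginary part; the factor
  \<open>- \<i> / 2\<close> is 1 / (2 i).\<close>

definition of_op :: "complex mat \<Rightarrow> cpair" where
  "of_op A = ((1 / 2) \<cdot>\<^sub>m (A + mat_adjoint A), (- \<i> / 2) \<cdot>\<^sub>m (A - mat_adjoint A))"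

lemma hermitian_pairsD:
  assumes "X \<in> hermitian_pairs n"
  shows "0 < n" "fst X \<in> carrier_mat n n" "snd X \<in> carrier_mat n n"
    "mat_adjoint (fst X) = fst X" "mat_adjoint (snd X) = snd X"
  using assms by (auto simp: hermitian_pairs_def)

lemma index_self_adjoint:
  fixes A :: "complex mat"
  assumes "A \<in> carrier_mat n n" "mat_adjoint A = A" "i < n" "j < n"
  shows "cnj (A $$ (i, j)) = A $$ (j, i)"
  using assms index_mat_adjoint[of j A i] by simp

lemma to_op_carrier [simp]: "X \<in> hermitian_pairs n \<Longrightarrow> to_op X \<in> carrier_mat n n"
  by (auto simp: hermitian_pairs_def to_op_def)

lemma of_op_hermitian: "A \<in> carrier_mat n n \<Longrightarrow> 0 < n \<Longrightarrow> of_op A \<in> hermitian_pairs n"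
  by (auto simp: hermitian_pairs_def of_op_def algebra_simps intro!: eq_matI)

lemma to_op_of_op: "A \<in> carrier_mat n n \<Longrightarrow> to_op (of_op A) = A"
  by (intro eq_matI) (auto simp: of_op_def to_op_def field_simps)

lemma of_op_to_op:
  assumes "X \<in> hermitian_pairs n"
  shows "of_op (to_op X) = X"
proof -
  note X = hermitian_pairsD[OF assms]
  show ?thesis
    using X index_self_adjoint[OF X(2,4)] index_self_adjoint[OF X(3,5)]
    by (auto simp: of_op_def to_op_def field_simps intro!: eq_matI prod_eqI)
qed

lemma mat_adjoint_to_op:
  assumes "X \<in> hermitian_pairs n"
  shows "mat_adjoint (to_op X) = fst X - \<i> \<cdot>\<^sub>m snd X"
proof -
  note X = hermitian_pairsD[OF assms]
  show ?thesis
    using X index_self_adjoint[OF X(2,4)] index_self_adjoint[OF X(3,5)]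
    by (auto simp: to_op_def intro!: eq_matI)
qed

lemma compress_hermitian:
  assumes "X \<in> hermitian_pairs n" "V \<in> carrier_mat n m" "0 < m"
  shows "compress V X \<in> hermitian_pairs m"
  using hermitian_pairsD[OF assms(1)] assms(2,3)
  by (auto simp: hermitian_pairs_def compress_def mat_adjoint_mult mult_mat_assoc)

lemma to_op_compress:
  assumes "X \<in> hermitian_pairs n" "V \<in> carrier_mat n m"
  shows "to_op (compress V X) = mat_adjoint V * to_op X * V"
  using hermitian_pairsD[OF assms(1)] assms(2)
  by (simp add: to_op_def compress_def mult_mat_add_left mult_mat_add_right mult_mat_smult)

lemma to_op_inject:
  assumes "X \<in> hermitian_pairs n" "Y \<in> hermitian_pairs m" "to_op X = to_op Y"
  shows "X = Y"
  using assms by (metis of_op_to_op)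

lemma to_op_block_pair:
  assumes "X \<in> hermitian_pairs n" "\<beta> \<in> hermitian_pairs m"
    "fst \<alpha> \<in> carrier_mat n m" "snd \<alpha> \<in> carrier_mat n m"
  shows "to_op (block_pair X \<alpha> \<beta>) = four_block_mat (to_op X) (fst \<alpha> + \<i> \<cdot>\<^sub>m snd \<alpha>)
    (mat_adjoint (fst \<alpha>) + \<i> \<cdot>\<^sub>m mat_adjoint (snd \<alpha>)) (to_op \<beta>)"
  using hermitian_pairsD[OF assms(1)] hermitian_pairsD[OF assms(2)] assms(3,4)
  by (intro eq_matI) (auto simp: to_op_def block_pair_def)

lemma block_pair_hermitian:
  assumes "X \<in> hermitian_pairs n" "\<beta> \<in> hermitian_pairs m"
    "fst \<alpha> \<in> carrier_mat n m" "snd \<alpha> \<in> carrier_mat n m"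
  shows "block_pair X \<alpha> \<beta> \<in> hermitian_pairs (n + m)"
  using hermitian_pairsD[OF assms(1)] hermitian_pairsD[OF assms(2)] assms(3,4)
  by (auto simp: hermitian_pairs_def block_pair_def mat_adjoint_four_block)

lemma direct_sum_pair_block_pair: "direct_sum_pair n m X Y = block_pair X (0\<^sub>m n m, 0\<^sub>m n m) Y"
  by (simp add: direct_sum_pair_def block_pair_def)

lemma direct_sum_pair_hermitian:
  assumes "X \<in> hermitian_pairs n" "Y \<in> hermitian_pairs m"
  shows "direct_sum_pair n m X Y \<in> hermitian_pairs (n + m)"
  unfolding direct_sum_pair_block_pair using assms by (intro block_pair_hermitian) auto

lemma to_op_direct_sum_pair:
  assumes "X \<in> hermitian_pairs n" "Y \<in> hermitian_pairs m"
  shows "to_op (direct_sum_pair n m X Y) = four_block_mat (to_op X) (0\<^sub>m n m) (0\<^sub>m m n) (to_op Y)"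
  unfolding direct_sum_pair_block_pair using assms by (subst to_op_block_pair) auto

section \<open>The spin disk as the set of contractions\<close>

definition contraction_mat :: "nat \<Rightarrow> complex mat \<Rightarrow> bool" where
  "contraction_mat n A \<longleftrightarrow> A \<in> carrier_mat n n \<and>
     (\<forall>v \<in> carrier_vec n. vec_sq (A *\<^sub>v v) \<le> vec_sq v)"

lemma contraction_mat_form:
  assumes A: "A \<in> carrier_mat n n"
  shows "contraction_mat n A \<longleftrightarrow> (\<forall>f \<in> carrier_vec n. \<forall>g \<in> carrier_vec n.
    0 \<le> vec_sq f + vec_sq g + 2 * Re ((A *\<^sub>v f) \<bullet>c g))"
proof
  assume L: "contraction_mat n A"
  show "\<forall>f \<in> carrier_vec n. \<forall>g \<in> carrier_vec n.
    0 \<le> vec_sq f + vec_sq g + 2 * Re ((A *\<^sub>v f) \<bullet>c g)"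
  proof (intro ballI)
    fix f g :: "complex vec" assume fg: "f \<in> carrier_vec n" "g \<in> carrier_vec n"
    have "0 \<le> vec_sq (A *\<^sub>v f + g)"
      by simp
    also have "\<dots> = vec_sq (A *\<^sub>v f) + vec_sq g + 2 * Re ((A *\<^sub>v f) \<bullet>c g)"
      using A fg by (simp add: vec_sq_add)
    also have "vec_sq (A *\<^sub>v f) \<le> vec_sq f"
      using L fg by (simp add: contraction_mat_def)
    finally show "0 \<le> vec_sq f + vec_sq g + 2 * Re ((A *\<^sub>v f) \<bullet>c g)"
      by simp
  qed
next
  assume R: "\<forall>f \<in> carrier_vec n. \<forall>g \<in> carrier_vec n.
    0 \<le> vec_sq f + vec_sq g + 2 * Re ((A *\<^sub>v f) \<bullet>c g)"
  have "vec_sq (A *\<^sub>v f) \<le> vec_sq f" if f: "f \<in> carrier_vec n" for f :: "complex vec"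
  proof -
    have "0 \<le> vec_sq f + vec_sq ((- 1) \<cdot>\<^sub>v (A *\<^sub>v f))
        + 2 * Re ((A *\<^sub>v f) \<bullet>c ((- 1) \<cdot>\<^sub>v (A *\<^sub>v f)))"
      using R f A by (metis mult_mat_vec_carrier smult_carrier_vec)
    then show ?thesis
      by (simp add: vec_sq_smult cscalar_prod_smult_right cscalar_prod_self)
  qed
  then show "contraction_mat n A"
    using A by (simp add: contraction_mat_def)
qed

text \<open>The form of \<open>contraction_mat_form\<close> is unchanged when f and g are exchanged
  along with A and its adjoint.\<close>

lemma contraction_mat_adjoint:
  assumes "contraction_mat n A"
  shows "contraction_mat n (mat_adjoint A)"
proof -
  have A: "A \<in> carrier_mat n n"
    using assms by (simp add: contraction_mat_def)
  have "Re ((mat_adjoint A *\<^sub>v f) \<bullet>c g) = Re ((A *\<^sub>v g) \<bullet>c f)"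
    if "f \<in> carrier_vec n" "g \<in> carrier_vec n" for f g :: "complex vec"
  proof -
    have "(mat_adjoint A *\<^sub>v f) \<bullet>c g = f \<bullet>c (A *\<^sub>v g)"
      using cscalar_prod_mult_mat_vec[of "mat_adjoint A" n n f g] A that by simp
    also have "\<dots> = cnj ((A *\<^sub>v g) \<bullet>c f)"
      using A that by (subst cnj_cscalar_prod) auto
    finally show ?thesis
      by simp
  qed
  then show ?thesis
    using assms unfolding contraction_mat_form[OF A] contraction_mat_form[OF mat_adjoint_carrier[OF A]]
    by (metis add.commute)
qed

lemma self_adjoint_form:
  fixes M :: "complex mat"
  assumes "M \<in> carrier_mat n n" "mat_adjoint M = M" "v \<in> carrier_vec n" "w \<in> carrier_vec n"
  shows "(M *\<^sub>v v) \<bullet>c w = cnj ((M *\<^sub>v w) \<bullet>c v)"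
  using cscalar_prod_mult_mat_vec[of M n n v w] cnj_cscalar_prod[of "M *\<^sub>v w" v] assms by simp

text \<open>The substitution (u, w) to (f, g) is the square root of 2 times a unitary, which
  accounts for the division by 2. It diagonalizes the coefficient matrices in the sense that X1 and
  X2 enter only through A = X1 + i X2.\<close>

lemma spin_form:
  assumes "X \<in> hermitian_pairs n" and u: "u \<in> carrier_vec n" and w: "w \<in> carrier_vec n"
  defines "B \<equiv> four_block_mat (1\<^sub>m n + fst X) (snd X) (snd X) (1\<^sub>m n - fst X)"
  defines "f \<equiv> u + (- \<i>) \<cdot>\<^sub>v w" and "g \<equiv> u + \<i> \<cdot>\<^sub>v w"
  shows "(B *\<^sub>v (u @\<^sub>v w)) \<bullet>c (u @\<^sub>v w) =
    complex_of_real ((vec_sq f + vec_sq g + 2 * Re ((to_op X *\<^sub>v f) \<bullet>c g)) / 2)"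
proof -
  note X = hermitian_pairsD[OF assms(1)]
  let ?P = "\<lambda>x y. (fst X *\<^sub>v x) \<bullet>c y" and ?Q = "\<lambda>x y. (snd X *\<^sub>v x) \<bullet>c y"
  have "B *\<^sub>v (u @\<^sub>v w) = (u + fst X *\<^sub>v u + snd X *\<^sub>v w) @\<^sub>v (snd X *\<^sub>v u + (w - fst X *\<^sub>v w))"
    unfolding B_def using X u w
    by (subst four_block_mat_mult_vec[of _ n n _ n _ n])
      (auto simp: mult_mat_vec_simps intro: minus_carrier_mat)
  then have B: "(B *\<^sub>v (u @\<^sub>v w)) \<bullet>c (u @\<^sub>v w) = of_real (vec_sq u + vec_sq w) + ?P u u - ?P w w
      + ?Q u w + ?Q w u"
    using X u w by (simp add: cscalar_prod_append cscalar_prod_simps cscalar_prod_self)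
  have sq: "vec_sq f + vec_sq g = 2 * (vec_sq u + vec_sq w)"
    using u w by (simp add: f_def g_def vec_sq_add vec_sq_smult cscalar_prod_smult_right)
  have A: "(to_op X *\<^sub>v f) \<bullet>c g = ?P u u - ?P w w - \<i> * (?P u w + ?P w u)
      + \<i> * (?Q u u - ?Q w w) + ?Q u w + ?Q w u"
    unfolding to_op_def f_def g_def using X u w
    by (simp add: mult_mat_vec_simps cscalar_prod_simps algebra_simps)
  \<comment> \<open>Self-adjointness makes the diagonal values and the sums of conjugate mixed
    values real, so exactly the terms with a factor i drop out of the real part.\<close>
  have "?P u u = cnj (?P u u)" "?P w w = cnj (?P w w)" "?P u w = cnj (?P w u)"
    "?Q u u = cnj (?Q u u)" "?Q w w = cnj (?Q w w)" "?Q u w = cnj (?Q w u)"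
    using X u w by (blast intro: self_adjoint_form[of _ n])+
  then show ?thesis
    unfolding B A sq by (simp add: complex_eq_iff)
qed

theorem spin_disk_iff_contraction:
  "X \<in> spin_disk n \<longleftrightarrow> X \<in> hermitian_pairs n \<and> contraction_mat n (to_op X)"
proof (cases "X \<in> hermitian_pairs n")
  case True
  note X = hermitian_pairsD[OF True]
  define B where "B = four_block_mat (1\<^sub>m n + fst X) (snd X) (snd X) (1\<^sub>m n - fst X)"
  have B: "B \<in> carrier_mat (n + n) (n + n)" "mat_adjoint B = B"
    using X by (auto simp: B_def mat_adjoint_add mat_adjoint_minus mat_adjoint_four_block)
  have "psd_mat (n + n) B \<longleftrightarrow> (\<forall>f \<in> carrier_vec n. \<forall>g \<in> carrier_vec n.
      0 \<le> vec_sq f + vec_sq g + 2 * Re ((to_op X *\<^sub>v f) \<bullet>c g))" (is "_ \<longleftrightarrow> ?R")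
  proof
    assume L: "psd_mat (n + n) B"
    show ?R
    proof (intro ballI)
      fix f g :: "complex vec" assume fg: "f \<in> carrier_vec n" "g \<in> carrier_vec n"
      \<comment> \<open>\<open>u\<close> and \<open>w\<close> solve f = u - i w and g = u + i w, so
        every pair (f, g) is reached.\<close>
      define u where "u = (1 / 2) \<cdot>\<^sub>v (f + g)"
      define w where "w = (\<i> / 2) \<cdot>\<^sub>v (f - g)"
      have uw: "u \<in> carrier_vec n" "w \<in> carrier_vec n"
        using fg by (auto simp: u_def w_def)
      have "f = u + (- \<i>) \<cdot>\<^sub>v w" "g = u + \<i> \<cdot>\<^sub>v w"
        using fg by (auto simp: u_def w_def field_simps intro!: eq_vecI)
      moreover have "0 \<le> (B *\<^sub>v (u @\<^sub>v w)) \<bullet>c (u @\<^sub>v w)"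
        using L uw by (auto simp: psd_mat_def)
      ultimately show "0 \<le> vec_sq f + vec_sq g + 2 * Re ((to_op X *\<^sub>v f) \<bullet>c g)"
        using spin_form[OF True uw] unfolding B_def[symmetric] by (simp add: less_eq_complex_def)
    qed
  next
    assume R: ?R
    have "0 \<le> (B *\<^sub>v v) \<bullet>c v" if v: "v \<in> carrier_vec (n + n)" for v
    proof -
      obtain u w where uw: "u \<in> carrier_vec n" "w \<in> carrier_vec n" "v = u @\<^sub>v w"
        using vec_first_last_append[OF v] vec_first_carrier[of v n] vec_last_carrier[of v n]
        by metis
      show ?thesis
        using R uw(1,2) unfolding uw(3) B_def spin_form[OF True uw(1,2)]
        by (simp add: less_eq_complex_def del: Re_divide_numeral)
    qed
    then show "psd_mat (n + n) B"
      using B by (simp add: psd_mat_def)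
  qed
  then show ?thesis
    using True by (simp add: spin_disk_def contraction_mat_form B_def case_prod_beta)
qed (auto simp: spin_disk_def)


section \<open>Factorization of positive matrices\<close>

lemma psd_mat_form:
  assumes "psd_mat n P" "v \<in> carrier_vec n"
  shows "(P *\<^sub>v v) \<bullet>c v = complex_of_real (Re ((P *\<^sub>v v) \<bullet>c v))" "0 \<le> Re ((P *\<^sub>v v) \<bullet>c v)"
  using assms by (auto simp: psd_mat_def less_eq_complex_def complex_eq_iff)

text \<open>The form is nonnegative at v + t w. Taking t as a real multiple r of the conjugate of z
  aligns the phases and leaves a real quadratic in r. For s > 0 its value at the minimum r = - 1 / s
  is the claim; for s = 0 it is affine in r, and nonnegativity everywhere forces z = 0.\<close>

lemma psd_mat_cauchy_schwarz:
  assumes P: "psd_mat n P" and v: "v \<in> carrier_vec n" and w: "w \<in> carrier_vec n"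
  shows "(cmod ((P *\<^sub>v w) \<bullet>c v))\<^sup>2 \<le> Re ((P *\<^sub>v w) \<bullet>c w) * Re ((P *\<^sub>v v) \<bullet>c v)"
proof -
  have Pc: "P \<in> carrier_mat n n" "mat_adjoint P = P"
    using P by (auto simp: psd_mat_def)
  define z where "z = (P *\<^sub>v w) \<bullet>c v"
  define s where "s = Re ((P *\<^sub>v w) \<bullet>c w)"
  define q where "q = Re ((P *\<^sub>v v) \<bullet>c v)"
  have z': "(P *\<^sub>v v) \<bullet>c w = cnj z"
    unfolding z_def using Pc v w by (intro self_adjoint_form)
  have nonneg: "0 \<le> s" "0 \<le> q"
    using psd_mat_form(2)[OF P] v w by (auto simp: s_def q_def)
  have *: "0 \<le> q + 2 * r * (cmod z)\<^sup>2 + r\<^sup>2 * (cmod z)\<^sup>2 * s" for r :: real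
  proof -
    let ?t = "complex_of_real r * cnj z"
    have "0 \<le> Re ((P *\<^sub>v (v + ?t \<cdot>\<^sub>v w)) \<bullet>c (v + ?t \<cdot>\<^sub>v w))"
      using v w by (intro psd_mat_form(2)[OF P]) auto
    also have "(P *\<^sub>v (v + ?t \<cdot>\<^sub>v w)) \<bullet>c (v + ?t \<cdot>\<^sub>v w)
        = of_real q + ?t * z + cnj ?t * cnj z + ?t * cnj ?t * of_real s"
      using Pc v w psd_mat_form(1)[OF P v] psd_mat_form(1)[OF P w]
      by (simp add: mult_mat_vec_simps cscalar_prod_simps z' algebra_simps q_def s_def
          flip: z_def)
    also have "Re \<dots> = q + 2 * r * (cmod z)\<^sup>2 + r\<^sup>2 * (cmod z)\<^sup>2 * s"
      unfolding cmod_power2 by (simp add: power2_eq_square algebra_simps)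
    finally show ?thesis .
  qed
  have "(cmod z)\<^sup>2 \<le> s * q"
  proof (cases "s = 0")
    case True
    have "(cmod z)\<^sup>2 = 0"
    proof (rule ccontr)
      assume "(cmod z)\<^sup>2 \<noteq> 0"
      \<comment> \<open>This r makes the affine expression equal to - q - 2, which is
        negative.\<close>
      then have "2 * (- (q + 1) / (cmod z)\<^sup>2) * (cmod z)\<^sup>2 = - 2 * (q + 1)"
        by simp
      then show False
        using *[of "- (q + 1) / (cmod z)\<^sup>2"] True nonneg by simp
    qed
    then show ?thesis
      using True by simp
  next
    case False
    then have "0 < s"
      using nonneg by simp
    moreover have "0 \<le> q - (cmod z)\<^sup>2 / s"
      using *[of "- 1 / s"] False by (simp add: field_simps power2_eq_square)
    ultimately show ?thesis
      by (simp add: field_simps)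
  qed
  then show ?thesis
    by (simp add: z_def s_def q_def)
qed

text \<open>Cauchy-Schwarz for w against the vector P w bounds the fourth power of the norm of P w
  by zero.\<close>

lemma psd_mat_mult_vec_eq_0:
  assumes P: "psd_mat n P" and w: "w \<in> carrier_vec n" and 0: "Re ((P *\<^sub>v w) \<bullet>c w) = 0"
  shows "P *\<^sub>v w = 0\<^sub>v n"
proof -
  have Pw: "P *\<^sub>v w \<in> carrier_vec n"
    using P w by (auto simp: psd_mat_def)
  have "vec_sq (P *\<^sub>v w) = 0"
    using psd_mat_cauchy_schwarz[OF P Pw w] 0 by (simp add: cscalar_prod_self)
  then show ?thesis
    using vec_sq_eq_0_iff[OF Pw] by simp
qed

lemma psd_mat_defect:
  assumes "contraction_mat n A"
  shows "psd_mat n (1\<^sub>m n - mat_adjoint A * A)"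
    and "v \<in> carrier_vec n \<Longrightarrow>
      ((1\<^sub>m n - mat_adjoint A * A) *\<^sub>v v) \<bullet>c v = complex_of_real (vec_sq v - vec_sq (A *\<^sub>v v))"
proof -
  have A: "A \<in> carrier_mat n n"
    using assms by (simp add: contraction_mat_def)
  show *: "((1\<^sub>m n - mat_adjoint A * A) *\<^sub>v v) \<bullet>c v = complex_of_real (vec_sq v - vec_sq (A *\<^sub>v v))"
    if v: "v \<in> carrier_vec n" for v
  proof -
    have "(mat_adjoint A *\<^sub>v (A *\<^sub>v v)) \<bullet>c v = of_real (vec_sq (A *\<^sub>v v))"
      using cscalar_prod_mult_mat_vec[of "mat_adjoint A" n n "A *\<^sub>v v" v] A v
      by (simp add: cscalar_prod_self)
    then show ?thesis
      using A v by (simp add: mult_mat_vec_simps cscalar_prod_simps cscalar_prod_self)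
  qed
  have "mat_adjoint (1\<^sub>m n - mat_adjoint A * A) = 1\<^sub>m n - mat_adjoint A * A"
    using A by (simp add: mat_adjoint_minus mat_adjoint_mult)
  moreover have "1\<^sub>m n - mat_adjoint A * A \<in> carrier_mat n n"
    using A by auto
  ultimately show "psd_mat n (1\<^sub>m n - mat_adjoint A * A)"
    using assms * by (simp add: psd_mat_def contraction_mat_def less_eq_complex_def)
qed

text \<open>Cholesky elimination: subtracting the rank one matrix \<open>u u\<^sup>* / P\<^sub>k\<^sub>k\<close>, where \<open>u\<close> is column \<open>k\<close>
  of \<open>P\<close>, clears column \<open>k\<close> and preserves positivity by the Cauchy-Schwarz inequality.\<close>

lemma psd_mat_eliminate:
  assumes P: "psd_mat n P" and k: "k < n" and s: "P $$ (k, k) \<noteq> 0"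
  shows "psd_mat n (mat n n (\<lambda>(i, j). P $$ (i, j) - P $$ (i, k) * cnj (P $$ (j, k)) / P $$ (k, k)))"
    (is "psd_mat n ?R")
proof -
  have Pc: "P \<in> carrier_mat n n" "mat_adjoint P = P"
    using P by (auto simp: psd_mat_def)
  define u where "u = col P k"
  have u: "u \<in> carrier_vec n" "u = P *\<^sub>v unit_vec n k"
    using Pc k by (auto simp: u_def intro!: eq_vecI)
  have skk: "(P *\<^sub>v unit_vec n k) \<bullet>c unit_vec n k = P $$ (k, k)"
    using Pc k by (simp add: cscalar_prod_unit_vec)
  define s where "s = Re (P $$ (k, k))"
  have s_eq: "P $$ (k, k) = of_real s" "0 < s"
    using psd_mat_form[OF P unit_vec_carrier, of k] s unfolding skk s_def by (auto simp: less_le)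
  have "0 \<le> (?R *\<^sub>v v) \<bullet>c v" if v: "v \<in> carrier_vec n" for v
  proof -
    have "?R *\<^sub>v v = P *\<^sub>v v - ((v \<bullet>c u) / of_real s) \<cdot>\<^sub>v u"
    proof (intro eq_vecI)
      fix i assume "i < dim_vec (P *\<^sub>v v - ((v \<bullet>c u) / of_real s) \<cdot>\<^sub>v u)"
      then have i: "i < n"
        using carrier_vecD[OF u(1)] by simp
      have "(?R *\<^sub>v v) $ i = (\<Sum>j<n. P $$ (i, j) * v $ j - v $ j * cnj (P $$ (j, k)) * P $$ (i, k) / of_real s)"
        using i v s_eq by (simp add: scalar_prod_def atLeast0LessThan algebra_simps)
      also have "\<dots> = (P *\<^sub>v v) $ i - (v \<bullet>c u) / of_real s * u $ i"
        using i v Pc k by (simp add: scalar_prod_def atLeast0LessThan u_def sum_subtractf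
            sum_divide_distrib sum_distrib_right)
      finally show "(?R *\<^sub>v v) $ i = (P *\<^sub>v v - ((v \<bullet>c u) / of_real s) \<cdot>\<^sub>v u) $ i"
        using i carrier_vecD[OF u(1)] Pc by simp
    qed (use carrier_vecD[OF u(1)] in auto)
    then have "(?R *\<^sub>v v) \<bullet>c v = (P *\<^sub>v v) \<bullet>c v - (v \<bullet>c u) * (u \<bullet>c v) / of_real s"
      using Pc u(1) v by (simp add: cscalar_prod_simps)
    also have "v \<bullet>c u = cnj (u \<bullet>c v)"
      using u(1) v by (simp add: cnj_cscalar_prod)
    also have "cnj (u \<bullet>c v) * (u \<bullet>c v) = of_real ((cmod (u \<bullet>c v))\<^sup>2)"
      by (simp only: complex_norm_square mult.commute)
    also have "(P *\<^sub>v v) \<bullet>c v = of_real (Re ((P *\<^sub>v v) \<bullet>c v))"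
      by (rule psd_mat_form(1)[OF P v])
    finally have *: "(?R *\<^sub>v v) \<bullet>c v = of_real (Re ((P *\<^sub>v v) \<bullet>c v) - (cmod (u \<bullet>c v))\<^sup>2 / s)"
      by simp
    have "(cmod (u \<bullet>c v))\<^sup>2 \<le> s * Re ((P *\<^sub>v v) \<bullet>c v)"
      using psd_mat_cauchy_schwarz[OF P v unit_vec_carrier, of k] unfolding skk u(2) s_eq by simp
    then have "0 \<le> Re ((P *\<^sub>v v) \<bullet>c v) - (cmod (u \<bullet>c v))\<^sup>2 / s"
      using s_eq(2) by (simp add: field_simps)
    then show ?thesis
      unfolding * by (simp only: less_eq_complex_def zero_complex.sel Re_complex_of_real Im_complex_of_real)
  qed
  moreover have "mat_adjoint ?R = ?R"
    using Pc index_self_adjoint[OF Pc] s_eq by (intro eq_matI) auto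
  ultimately show ?thesis
    by (simp add: psd_mat_def)
qed

text \<open>The invariant pairs k cleared columns of P with k zero rows of C. The induction descends
  from k = n, where P vanishes. In the step, row k of the factor of the reduced matrix is still zero
  and can take the conjugate of column k of P divided by the root of the pivot.\<close>

lemma psd_mat_factor_aux:
  assumes "k \<le> n" "psd_mat n P" "\<And>i j. i < n \<Longrightarrow> j < k \<Longrightarrow> P $$ (i, j) = 0"
  shows "\<exists>C \<in> carrier_mat n n. (\<forall>i<k. \<forall>j<n. C $$ (i, j) = 0) \<and>
    (\<forall>i<n. \<forall>j<n. P $$ (i, j) = (\<Sum>l<n. cnj (C $$ (l, i)) * C $$ (l, j)))"
  using assms
proof (induction arbitrary: P rule: inc_induct)
  case base
  then show ?case
    by (intro bexI[of _ "0\<^sub>m n n"]) auto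
next
  case (step k)
  have Pc: "P \<in> carrier_mat n n" "mat_adjoint P = P"
    using step.prems by (auto simp: psd_mat_def)
  note sa = index_self_adjoint[OF Pc]
  have k: "k < n"
    using step.hyps by simp
  show ?case
  proof (cases "P $$ (k, k) = 0")
    case True
    \<comment> \<open>A positive matrix with a zero diagonal entry has a zero column there, so with
      a vanishing pivot there is nothing to eliminate and the induction hypothesis applies to
      \<open>P\<close> itself.\<close>
    have "P *\<^sub>v unit_vec n k = 0\<^sub>v n"
      using Pc k True
      by (intro psd_mat_mult_vec_eq_0[OF step.prems(1)]) (simp_all add: cscalar_prod_unit_vec)
    then have "P $$ (i, k) = 0" if "i < n" for i
      using that Pc k by (metis index_mult_mat_vec scalar_prod_right_unit index_row(1) carrier_matD index_zero_vec(1))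
    then have "P $$ (i, j) = 0" if "i < n" "j < Suc k" for i j
      using that step.prems(2) less_Suc_eq by auto
    from step.IH[OF step.prems(1) this] show ?thesis
      using less_Suc_eq by blast
  next
    case False
    define R where "R = mat n n (\<lambda>(i, j). P $$ (i, j) - P $$ (i, k) * cnj (P $$ (j, k)) / P $$ (k, k))"
    have R: "psd_mat n R"
      unfolding R_def using step.prems k False by (intro psd_mat_eliminate)
    \<comment> \<open>Column k cancels because the pivot is real. An earlier column stays clear
      because the subtracted term contains the conjugate of P at (j, k), which is P at (k, j) and
      already zero.\<close>
    have "R $$ (i, j) = 0" if "i < n" "j < Suc k" for i j
      using that k step.prems(2) sa[of j k] sa[of k j] sa[of k k] False
      by (cases "j = k") (auto simp: R_def)
    from step.IH[OF R this] obtain C where C: "C \<in> carrier_mat n n"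
      "\<forall>i<Suc k. \<forall>j<n. C $$ (i, j) = 0"
      "\<forall>i<n. \<forall>j<n. R $$ (i, j) = (\<Sum>l<n. cnj (C $$ (l, i)) * C $$ (l, j))"
      by blast
    have pos: "0 \<le> P $$ (k, k)"
    proof -
      have "0 \<le> (P *\<^sub>v unit_vec n k) \<bullet>c unit_vec n k"
        using step.prems(1) by (simp add: psd_mat_def)
      then show ?thesis
        using Pc k by (simp add: cscalar_prod_unit_vec)
    qed
    define s where "s = complex_of_real (sqrt (Re (P $$ (k, k))))"
    have s: "s * s = P $$ (k, k)" "cnj s = s" "s \<noteq> 0"
      using pos False by (auto simp: s_def less_eq_complex_def complex_eq_iff)
    define D where "D = mat n n (\<lambda>(l, j). if l = k then cnj (P $$ (j, k)) / s else C $$ (l, j))"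
    have "P $$ (i, j) = (\<Sum>l<n. cnj (D $$ (l, i)) * D $$ (l, j))" if ij: "i < n" "j < n" for i j
    proof -
      have "(\<Sum>l<n. cnj (D $$ (l, i)) * D $$ (l, j))
          = (\<Sum>l<n. cnj (C $$ (l, i)) * C $$ (l, j) + (if l = k then P $$ (i, k) * cnj (P $$ (j, k)) / (s * s) else 0))"
        using ij C(2) s by (intro sum.cong) (auto simp: D_def)
      also have "\<dots> = R $$ (i, j) + P $$ (i, k) * cnj (P $$ (j, k)) / P $$ (k, k)"
        using ij C(3) k by (simp add: sum.distrib s)
      finally show ?thesis
        using ij by (simp add: R_def)
    qed
    moreover have "D $$ (i, j) = 0" if "i < k" "j < n" for i j
      using that k C(2) by (simp add: D_def)
    ultimately show ?thesis
      by (intro bexI[of _ D]) (auto simp: D_def)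
  qed
qed

lemma psd_mat_factor:
  assumes "psd_mat n P"
  obtains C where "C \<in> carrier_mat n n" "P = mat_adjoint C * C"
proof -
  obtain C where C: "C \<in> carrier_mat n n"
    "\<forall>i<n. \<forall>j<n. P $$ (i, j) = (\<Sum>l<n. cnj (C $$ (l, i)) * C $$ (l, j))"
    using psd_mat_factor_aux[of 0 n P] assms by auto
  have "P = mat_adjoint C * C"
    using C assms by (intro eq_matI) (auto simp: psd_mat_def scalar_prod_def atLeast0LessThan)
  with C(1) show ?thesis
    by (rule that)
qed


section \<open>Isometries and unitary dilations\<close>

lemma index_mat_adjoint_mult:
  fixes V :: "complex mat"
  assumes "i < dim_col V" "j < dim_col W" "dim_row V = dim_row W"
  shows "(mat_adjoint V * W) $$ (i, j) = col W j \<bullet>c col V i"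
  using assms by (simp add: scalar_prod_def mult.commute)

lemma isometry_mat_iff_cols:
  "isometry_mat n m V \<longleftrightarrow> V \<in> carrier_mat n m \<and>
    (\<forall>i<m. \<forall>j<m. col V j \<bullet>c col V i = (if i = j then 1 else 0))"
proof (cases "V \<in> carrier_mat n m")
  case True
  then have "mat_adjoint V * V = 1\<^sub>m m \<longleftrightarrow>
      (\<forall>i<m. \<forall>j<m. (mat_adjoint V * V) $$ (i, j) = 1\<^sub>m m $$ (i, j))"
    by (auto intro!: eq_matI simp del: index_mult_mat(1))
  also have "\<dots> \<longleftrightarrow> (\<forall>i<m. \<forall>j<m. col V j \<bullet>c col V i = (if i = j then 1 else 0))"
    using True by (simp add: index_mat_adjoint_mult del: index_mult_mat)
  finally show ?thesis
    using True by (simp add: isometry_mat_def)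
qed (simp add: isometry_mat_def)

lemma isometry_mat_unitary:
  assumes "isometry_mat n n U"
  shows "U * mat_adjoint U = 1\<^sub>m n" "isometry_mat n n (mat_adjoint U)" "unitary_mat n U"
proof -
  have U: "U \<in> carrier_mat n n" "mat_adjoint U * U = 1\<^sub>m n"
    using assms by (auto simp: isometry_mat_def)
  show "U * mat_adjoint U = 1\<^sub>m n"
    by (rule mat_mult_left_right_inverse[OF _ U(1) U(2)]) (use U in simp)
  then show "isometry_mat n n (mat_adjoint U)" "unitary_mat n U"
    using U by (auto simp: isometry_mat_def unitary_mat_def)
qed

lemma isometry_mat_contraction: "isometry_mat n n A \<Longrightarrow> contraction_mat n A"
  by (simp add: contraction_mat_def vec_sq_isometry) (simp add: isometry_mat_def)

text \<open>Orthogonality to m vectors is m linear equations in n > m unknowns. Padding the system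
  with zero rows makes it square and singular, so a determinant argument gives a nonzero solution,
  which is then normalized.\<close>

lemma exists_orthogonal_unit_vec:
  assumes V: "V \<in> carrier_mat n m" and "m < n"
  obtains u where "u \<in> carrier_vec n" "vec_sq u = 1" "\<And>j. j < m \<Longrightarrow> u \<bullet>c col V j = 0"
proof -
  define W where "W = mat n n (\<lambda>(i, j). if i < m then cnj (V $$ (j, i)) else 0)"
  have W: "W \<in> carrier_mat n n"
    by (simp add: W_def)
  have "det W = 0"
  proof -
    \<comment> \<open>Row n - 1 of \<open>W\<close> is one of the padding rows, because m <
      n.\<close>
    have "transpose_mat W *\<^sub>v unit_vec n (n - 1) = 0\<^sub>v n"
      using assms by (intro eq_vecI) (auto simp: W_def)
    then have "det (transpose_mat W) = 0"
      using W assms unit_vec_nonzero[of "n - 1" n]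
      by (subst det_0_iff_vec_prod_zero[of _ n]) (auto intro!: exI[of _ "unit_vec n (n - 1)"])
    then show ?thesis
      using det_transpose[OF W] by simp
  qed
  then obtain x where x: "x \<in> carrier_vec n" "x \<noteq> 0\<^sub>v n" "W *\<^sub>v x = 0\<^sub>v n"
    using det_0_iff_vec_prod_zero[OF W] by blast
  have orth: "x \<bullet>c col V j = 0" if "j < m" for j
  proof -
    have "x \<bullet>c col V j = (W *\<^sub>v x) $ j"
      using that x(1) V \<open>m < n\<close> by (simp add: W_def scalar_prod_def mult.commute)
    then show ?thesis
      using that x(3) \<open>m < n\<close> by simp
  qed
  have pos: "vec_sq x \<noteq> 0"
    using vec_sq_eq_0_iff[OF x(1)] x(2) by simp
  define u where "u = complex_of_real (1 / sqrt (vec_sq x)) \<cdot>\<^sub>v x"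
  have "vec_sq u = 1"
    using pos by (simp add: u_def vec_sq_smult norm_divide power_divide)
  moreover have "u \<in> carrier_vec n"
    using x by (simp add: u_def)
  moreover have "u \<bullet>c col V j = 0" if "j < m" for j
    using that x(1) V orth[OF that] by (simp add: u_def cscalar_prod_simps)
  ultimately show ?thesis
    using that by blast
qed

text \<open>The induction descends from m = n; each step appends one unit vector orthogonal to the
  columns already there.\<close>

lemma isometry_mat_extend:
  assumes "m \<le> n" "isometry_mat n m V"
  shows "\<exists>U. isometry_mat n n U \<and> (\<forall>i<n. \<forall>j<m. U $$ (i, j) = V $$ (i, j))"
  using assms
proof (induction arbitrary: V rule: inc_induct)
  case base
  then show ?case
    by blast
next
  case (step m)
  have V: "V \<in> carrier_mat n m" "\<And>i j. i < m \<Longrightarrow> j < m \<Longrightarrow> col V j \<bullet>c col V i = (if i = j then 1 else 0)"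
    using step.prems by (auto simp: isometry_mat_iff_cols)
  obtain u where u: "u \<in> carrier_vec n" "vec_sq u = 1" "\<And>j. j < m \<Longrightarrow> u \<bullet>c col V j = 0"
    using exists_orthogonal_unit_vec[OF V(1)] step.hyps by auto
  define W where "W = mat n (Suc m) (\<lambda>(i, j). if j < m then V $$ (i, j) else u $ i)"
  have W: "W \<in> carrier_mat n (Suc m)" "\<And>j. j < m \<Longrightarrow> col W j = col V j" "col W m = u"
    using V(1) u(1) by (auto simp: W_def intro!: eq_vecI)
  have "col W j \<bullet>c col W i = (if i = j then 1 else 0)" if "i < Suc m" "j < Suc m" for i j
  proof -
    have "col V j \<bullet>c u = 0" if "j < m" for j
      using u(3)[OF that] cnj_cscalar_prod[of u "col V j"] u(1) V(1) that by simp
    then show ?thesis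
      using that V(2) W u(3) by (cases "i = m"; cases "j = m") (auto simp: cscalar_prod_self u(2))
  qed
  then have "isometry_mat n (Suc m) W"
    using W(1) by (simp add: isometry_mat_iff_cols)
  from step.IH[OF this] obtain U where U: "isometry_mat n n U"
    "\<forall>i<n. \<forall>j<Suc m. U $$ (i, j) = W $$ (i, j)"
    by blast
  then show ?case
    by (intro exI[of _ U]) (auto simp: W_def)
qed

text \<open>For m \<le> n this is the embedding of the first m coordinates, and compression by it
  cuts out the upper left block.\<close>

definition corner_mat :: "nat \<Rightarrow> nat \<Rightarrow> complex mat" where
  "corner_mat n m = mat n m (\<lambda>(i, j). if i = j then 1 else 0)"

lemma corner_mat_carrier [simp]: "corner_mat n m \<in> carrier_mat n m"
  by (simp add: corner_mat_def)

lemma col_corner_mat: "m \<le> n \<Longrightarrow> j < m \<Longrightarrow> col (corner_mat n m) j = unit_vec n j"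
  by (intro eq_vecI) (auto simp: corner_mat_def)

lemma isometry_corner_mat: "m \<le> n \<Longrightarrow> isometry_mat n m (corner_mat n m)"
  by (auto simp: isometry_mat_iff_cols col_corner_mat cscalar_prod_unit_vec)

lemma index_corner_compression:
  assumes "U \<in> carrier_mat n n" "m \<le> n" "i < m" "j < m"
  shows "(mat_adjoint (corner_mat n m) * U * corner_mat n m) $$ (i, j) = U $$ (i, j)"
proof -
  have "col (U * corner_mat n m) j = col U j"
    using assms by (intro eq_vecI) (auto simp: col_mult2[of U n n _ m] col_corner_mat)
  moreover have "mat_adjoint (corner_mat n m) * U * corner_mat n m
      = mat_adjoint (corner_mat n m) * (U * corner_mat n m)"
    using assms by (subst mult_mat_assoc) (auto simp: corner_mat_def)
  moreover have "(mat_adjoint (corner_mat n m) * (U * corner_mat n m)) $$ (i, j)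
      = col (U * corner_mat n m) j \<bullet>c col (corner_mat n m) i"
    using assms by (intro index_mat_adjoint_mult) (auto simp: corner_mat_def)
  ultimately show ?thesis
    using assms by (simp add: col_corner_mat cscalar_prod_unit_vec)
qed

text \<open>The stacked columns of A and C are orthonormal since A* A + C* C = I. The corner lies
  within these n columns, so their completion to a unitary may be arbitrary.\<close>

lemma contraction_unitary_dilation:
  assumes "contraction_mat n A"
  obtains U where "isometry_mat (n + n) (n + n) U"
    "mat_adjoint (corner_mat (n + n) n) * U * corner_mat (n + n) n = A"
proof -
  have A: "A \<in> carrier_mat n n"
    using assms by (simp add: contraction_mat_def)
  obtain C where C: "C \<in> carrier_mat n n" "1\<^sub>m n - mat_adjoint A * A = mat_adjoint C * C"
    by (rule psd_mat_factor[OF psd_mat_defect(1)[OF assms]])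
  define V where "V = mat (n + n) n (\<lambda>(i, j). if i < n then A $$ (i, j) else C $$ (i - n, j))"
  have col: "col V j = col A j @\<^sub>v col C j" if "j < n" for j
    using that A C(1) by (intro eq_vecI) (auto simp: V_def)
  have "col V j \<bullet>c col V i = (if i = j then 1 else 0)" if ij: "i < n" "j < n" for i j
  proof -
    have "(mat_adjoint A * A) $$ (i, j) + (mat_adjoint C * C) $$ (i, j) = (if i = j then 1 else 0)"
      using ij A unfolding C(2)[symmetric] by simp
    then show ?thesis
      using ij A C(1) by (simp add: col cscalar_prod_append index_mat_adjoint_mult del: index_mult_mat)
  qed
  then have "isometry_mat (n + n) n V"
    by (simp add: isometry_mat_iff_cols V_def)
  with isometry_mat_extend[of n "n + n" V] obtain U where U: "isometry_mat (n + n) (n + n) U"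
    "\<forall>i<n + n. \<forall>j<n. U $$ (i, j) = V $$ (i, j)"
    by auto
  moreover have "mat_adjoint (corner_mat (n + n) n) * U * corner_mat (n + n) n = A"
  proof (intro eq_matI)
    fix i j assume "i < dim_row A" "j < dim_col A"
    then have ij: "i < n" "j < n"
      using A by auto
    then have "(mat_adjoint (corner_mat (n + n) n) * U * corner_mat (n + n) n) $$ (i, j) = U $$ (i, j)"
      using U(1) by (intro index_corner_compression) (auto simp: isometry_mat_def)
    also have "\<dots> = A $$ (i, j)"
      using ij U(2) by (simp add: V_def)
    finally show "(mat_adjoint (corner_mat (n + n) n) * U * corner_mat (n + n) n) $$ (i, j) = A $$ (i, j)" .
  qed (use A in \<open>auto simp: corner_mat_def\<close>)
  ultimately show ?thesis
    using that by blast
qed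


section \<open>Matrix convexity and the Arveson boundary\<close>

text \<open>V preserves norms, and its adjoint does not increase them: the squared norm of x - V V*
  x is that of x minus that of V* x.\<close>

lemma contraction_mat_compress:
  assumes A: "contraction_mat n A" and V: "isometry_mat n m V" and "m \<le> n"
  shows "contraction_mat m (mat_adjoint V * A * V)"
proof -
  have c: "A \<in> carrier_mat n n" "V \<in> carrier_mat n m"
    using A V by (auto simp: contraction_mat_def isometry_mat_def)
  have V': "vec_sq (mat_adjoint V *\<^sub>v x) \<le> vec_sq x" if x: "x \<in> carrier_vec n" for x
  proof -
    have Vx: "mat_adjoint V *\<^sub>v x \<in> carrier_vec m"
      using mult_mat_vec_carrier[OF mat_adjoint_carrier[OF c(2)] x] .
    have "vec_sq (x + (- 1) \<cdot>\<^sub>v (V *\<^sub>v (mat_adjoint V *\<^sub>v x)))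
        = vec_sq x + vec_sq (mat_adjoint V *\<^sub>v x) - 2 * Re (x \<bullet>c (V *\<^sub>v (mat_adjoint V *\<^sub>v x)))"
      using c x vec_sq_isometry[OF V Vx]
      by (simp add: vec_sq_add vec_sq_smult cscalar_prod_smult_right)
    also have "x \<bullet>c (V *\<^sub>v (mat_adjoint V *\<^sub>v x)) = of_real (vec_sq (mat_adjoint V *\<^sub>v x))"
      using cscalar_prod_mult_mat_vec[OF mat_adjoint_carrier[OF c(2)] x Vx]
      by (simp add: cscalar_prod_self)
    finally show ?thesis
      using vec_sq_nonneg[of "x + (- 1) \<cdot>\<^sub>v (V *\<^sub>v (mat_adjoint V *\<^sub>v x))"] by simp
  qed
  have "vec_sq ((mat_adjoint V * A * V) *\<^sub>v x) \<le> vec_sq x" if x: "x \<in> carrier_vec m" for x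
  proof -
    have "(mat_adjoint V * A * V) *\<^sub>v x = mat_adjoint V *\<^sub>v (A *\<^sub>v (V *\<^sub>v x))"
      using c x by (simp add: mult_mat_mat_vec mult_mat_assoc)
    also have "vec_sq \<dots> \<le> vec_sq (A *\<^sub>v (V *\<^sub>v x))"
      using c x by (intro V') auto
    also have "\<dots> \<le> vec_sq (V *\<^sub>v x)"
      using A c x by (simp add: contraction_mat_def)
    also have "\<dots> = vec_sq x"
      by (rule vec_sq_isometry[OF V x])
    finally show ?thesis .
  qed
  then show ?thesis
    using mult_carrier_mat[OF mult_carrier_mat[OF mat_adjoint_carrier[OF c(2)] c(1)] c(2)]
    by (simp add: contraction_mat_def)
qed

lemma four_block_mult_first:
  fixes A :: "complex mat"
  assumes "A \<in> carrier_mat n n" "B \<in> carrier_mat n m" "C \<in> carrier_mat m n" "D \<in> carrier_mat m m"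
    "f \<in> carrier_vec n"
  shows "four_block_mat A B C D *\<^sub>v (f @\<^sub>v 0\<^sub>v m) = (A *\<^sub>v f) @\<^sub>v (C *\<^sub>v f)"
proof -
  have "M *\<^sub>v 0\<^sub>v m = 0\<^sub>v k" if "M \<in> carrier_mat k m" for M :: "complex mat" and k
    using that by (intro eq_vecI) auto
  then show ?thesis
    using assms by (subst four_block_mat_mult_vec[of _ n n _ m _ m]) auto
qed

lemma four_block_mult_second:
  fixes A :: "complex mat"
  assumes "A \<in> carrier_mat n n" "B \<in> carrier_mat n m" "C \<in> carrier_mat m n" "D \<in> carrier_mat m m"
    "g \<in> carrier_vec m"
  shows "four_block_mat A B C D *\<^sub>v (0\<^sub>v n @\<^sub>v g) = (B *\<^sub>v g) @\<^sub>v (D *\<^sub>v g)"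
proof -
  have "M *\<^sub>v 0\<^sub>v n = 0\<^sub>v k" if "M \<in> carrier_mat k n" for M :: "complex mat" and k
    using that by (intro eq_vecI) auto
  then show ?thesis
    using assms by (subst four_block_mat_mult_vec[of _ n n _ m _ m]) auto
qed

lemma vec_sq_zero [simp]: "vec_sq (0\<^sub>v n) = 0"
  by (simp add: vec_sq_def)

lemma contraction_mat_direct_sum:
  assumes A: "A \<in> carrier_mat n n" and B: "B \<in> carrier_mat m m"
  shows "contraction_mat (n + m) (four_block_mat A (0\<^sub>m n m) (0\<^sub>m m n) B) \<longleftrightarrow>
    contraction_mat n A \<and> contraction_mat m B" (is "contraction_mat _ ?T \<longleftrightarrow> _")
proof (intro iffI conjI)
  assume T: "contraction_mat (n + m) ?T"
  have "vec_sq (A *\<^sub>v f) \<le> vec_sq f" if f: "f \<in> carrier_vec n" for f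
  proof -
    have "vec_sq (?T *\<^sub>v (f @\<^sub>v 0\<^sub>v m)) \<le> vec_sq (f @\<^sub>v 0\<^sub>v m)"
      using T f by (auto simp: contraction_mat_def)
    then show ?thesis
      using A B f by (simp add: four_block_mult_first vec_sq_append)
  qed
  then show "contraction_mat n A"
    using A by (simp add: contraction_mat_def)
  have "vec_sq (B *\<^sub>v g) \<le> vec_sq g" if g: "g \<in> carrier_vec m" for g
  proof -
    have "vec_sq (?T *\<^sub>v (0\<^sub>v n @\<^sub>v g)) \<le> vec_sq (0\<^sub>v n @\<^sub>v g)"
      using T g by (auto simp: contraction_mat_def)
    then show ?thesis
      using A B g four_block_mult_second[of A n "0\<^sub>m n m" m "0\<^sub>m m n" B g]
      by (simp add: vec_sq_append)
  qed
  then show "contraction_mat m B"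
    using B by (simp add: contraction_mat_def)
next
  assume AB: "contraction_mat n A \<and> contraction_mat m B"
  have "vec_sq (?T *\<^sub>v v) \<le> vec_sq v" if v: "v \<in> carrier_vec (n + m)" for v
  proof -
    obtain f g where fg: "f \<in> carrier_vec n" "g \<in> carrier_vec m" "v = f @\<^sub>v g"
      using vec_first_last_append[OF v] vec_first_carrier[of v n] vec_last_carrier[of v m]
      by metis
    have "?T *\<^sub>v v = (A *\<^sub>v f) @\<^sub>v (B *\<^sub>v g)"
      unfolding fg(3) using A B fg by (intro mult_mat_vec_split)
    then show ?thesis
      using AB fg by (simp add: vec_sq_append contraction_mat_def add_mono)
  qed
  then show "contraction_mat (n + m) ?T"
    using A B by (simp add: contraction_mat_def)
qed

lemma spin_disk_compress:
  assumes "X \<in> spin_disk n" "isometry_mat n m V" "1 \<le> m" "m \<le> n"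
  shows "compress V X \<in> spin_disk m"
proof -
  have X: "X \<in> hermitian_pairs n" "contraction_mat n (to_op X)" and V: "V \<in> carrier_mat n m"
    using assms by (auto simp: spin_disk_iff_contraction isometry_mat_def)
  then show ?thesis
    using assms contraction_mat_compress[OF X(2) assms(2)]
    by (simp add: spin_disk_iff_contraction compress_hermitian to_op_compress)
qed

lemma matrix_convex_spin_disk: "matrix_convex spin_disk"
  unfolding matrix_convex_def
proof (intro conjI allI ballI impI)
  fix n m X Y assume "X \<in> spin_disk n" "Y \<in> spin_disk m"
  then show "direct_sum_pair n m X Y \<in> spin_disk (n + m)"
    by (simp add: spin_disk_iff_contraction direct_sum_pair_hermitian to_op_direct_sum_pair
        contraction_mat_direct_sum)
next
  fix n m V X assume "X \<in> spin_disk n" "1 \<le> m \<and> m \<le> n \<and> isometry_mat n m V"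
  then show "compress V X \<in> spin_disk m"
    by (simp add: spin_disk_compress)
qed (auto simp: spin_disk_iff_contraction)

text \<open>At a vector (f, 0) the isometric corner already uses up the whole norm of f, which
  leaves nothing for C f.\<close>

lemma contraction_block_lower_left:
  assumes T: "contraction_mat (n + m) (four_block_mat A B C D)" and A: "isometry_mat n n A"
    and c: "B \<in> carrier_mat n m" "C \<in> carrier_mat m n" "D \<in> carrier_mat m m"
  shows "C = 0\<^sub>m m n"
proof (rule mat_eqI_mult_mat_vec)
  fix f :: "complex vec" assume f: "f \<in> carrier_vec n"
  have Ac: "A \<in> carrier_mat n n"
    using A by (simp add: isometry_mat_def)
  have "vec_sq (four_block_mat A B C D *\<^sub>v (f @\<^sub>v 0\<^sub>v m)) \<le> vec_sq (f @\<^sub>v 0\<^sub>v m)"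
    using T f by (auto simp: contraction_mat_def)
  then have "vec_sq (C *\<^sub>v f) \<le> 0"
    using vec_sq_isometry[OF A f] c f Ac by (simp add: four_block_mult_first vec_sq_append)
  then have "vec_sq (C *\<^sub>v f) = 0"
    using vec_sq_nonneg[of "C *\<^sub>v f"] by simp
  then have "C *\<^sub>v f = 0\<^sub>v m"
    using vec_sq_eq_0_iff[of "C *\<^sub>v f" m] c f by simp
  also have "\<dots> = 0\<^sub>m m n *\<^sub>v f"
    using f by (intro eq_vecI) auto
  finally show "C *\<^sub>v f = 0\<^sub>m m n *\<^sub>v f" .
qed (use c in auto)

text \<open>The row \<open>\<gamma> = (P w)\<^sup>*/\<langle>P w, w\<rangle>\<^sup>1\<^sup>/\<^sup>2\<close> with \<open>P = I - A\<^sup>* A\<close> satisfies \<open>\<gamma>\<^sup>* \<gamma> \<le> P\<close>.\<close>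

lemma contraction_extend_row:
  assumes A: "contraction_mat n A" and ne: "\<not> isometry_mat n n A"
  obtains u where "u \<in> carrier_vec n" "u \<noteq> 0\<^sub>v n"
    "contraction_mat (n + 1)
      (four_block_mat A (0\<^sub>m n 1) (mat 1 n (\<lambda>(i, j). cnj (u $ j))) (0\<^sub>m 1 1))"
proof -
  have Ac: "A \<in> carrier_mat n n"
    using A by (simp add: contraction_mat_def)
  define P where "P = 1\<^sub>m n - mat_adjoint A * A"
  have P: "psd_mat n P"
    unfolding P_def by (rule psd_mat_defect(1)[OF A])
  have Pc: "P \<in> carrier_mat n n"
    using P by (simp add: psd_mat_def)
  have "\<exists>w \<in> carrier_vec n. P *\<^sub>v w \<noteq> 0\<^sub>v n"
  proof (rule ccontr)
    assume "\<not> ?thesis"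
    then have "P *\<^sub>v w = 0\<^sub>m n n *\<^sub>v w" if "w \<in> carrier_vec n" for w
      using that by (auto intro!: eq_vecI)
    then have P0: "P = 0\<^sub>m n n"
      using Pc by (intro mat_eqI_mult_mat_vec[of _ n n]) auto
    have "mat_adjoint A * A = 1\<^sub>m n"
    proof (intro eq_matI)
      fix i j assume "i < dim_row (1\<^sub>m n :: complex mat)" "j < dim_col (1\<^sub>m n :: complex mat)"
      then have "1\<^sub>m n $$ (i, j) - (mat_adjoint A * A) $$ (i, j) = 0"
        using arg_cong[OF P0[unfolded P_def], of "\<lambda>M. M $$ (i, j)"] Ac
        by (simp del: index_mult_mat(1) index_one_mat(1))
      then show "(mat_adjoint A * A) $$ (i, j) = 1\<^sub>m n $$ (i, j)"
        by simp
    qed (use Ac in auto)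
    then show False
      using ne Ac by (simp add: isometry_mat_def)
  qed
  then obtain w where w: "w \<in> carrier_vec n" "P *\<^sub>v w \<noteq> 0\<^sub>v n"
    by blast
  define s where "s = Re ((P *\<^sub>v w) \<bullet>c w)"
  have s: "0 < s"
    using psd_mat_form(2)[OF P w(1)] psd_mat_mult_vec_eq_0[OF P w(1)] w(2) by (auto simp: s_def less_le)
  define u where "u = complex_of_real (1 / sqrt s) \<cdot>\<^sub>v (P *\<^sub>v w)"
  have u: "u \<in> carrier_vec n"
    using Pc w by (simp add: u_def)
  have "u \<noteq> 0\<^sub>v n"
  proof
    assume "u = 0\<^sub>v n"
    then have "complex_of_real (sqrt s) \<cdot>\<^sub>v u = 0\<^sub>v n"
      by (auto intro!: eq_vecI)
    moreover have "complex_of_real (sqrt s) \<cdot>\<^sub>v u = P *\<^sub>v w"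
      using s Pc by (intro eq_vecI) (auto simp: u_def)
    ultimately show False
      using w(2) by simp
  qed
  let ?\<gamma> = "mat 1 n (\<lambda>(i, j). cnj (u $ j))"
  let ?T = "four_block_mat A (0\<^sub>m n 1) ?\<gamma> (0\<^sub>m 1 1)"
  have "vec_sq (?T *\<^sub>v v) \<le> vec_sq v" if v: "v \<in> carrier_vec (n + 1)" for v
  proof -
    obtain f g where fg: "f \<in> carrier_vec n" "g \<in> carrier_vec 1" "v = f @\<^sub>v g"
      using vec_first_last_append[OF v] vec_first_carrier[of v n] vec_last_carrier[of v 1]
      by metis
    have "?T *\<^sub>v v = (A *\<^sub>v f) @\<^sub>v (?\<gamma> *\<^sub>v f)"
    proof -
      have "0\<^sub>m k 1 *\<^sub>v g = 0\<^sub>v k" for k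
        using fg by (intro eq_vecI) auto
      then show ?thesis
        unfolding fg(3) using Ac fg by (subst four_block_mat_mult_vec[of _ n n _ 1 _ 1]) auto
    qed
    moreover have "vec_sq (?\<gamma> *\<^sub>v f) = (cmod (f \<bullet>c u))\<^sup>2"
    proof -
      have "?\<gamma> *\<^sub>v f = vec 1 (\<lambda>_. f \<bullet>c u)"
        using fg u by (intro eq_vecI) (auto simp: scalar_prod_def mult.commute)
      then show ?thesis
        by (simp only: vec_sq_vec_1)
    qed
    \<comment> \<open>This is Cauchy-Schwarz for \<open>P\<close>, divided by \<open>s\<close>: the
      new row adds at most the squared norm that \<open>A\<close> loses at \<open>f\<close>.\<close>
    moreover have "(cmod (f \<bullet>c u))\<^sup>2 \<le> vec_sq f - vec_sq (A *\<^sub>v f)"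
    proof -
      have "f \<bullet>c u = of_real (1 / sqrt s) * cnj ((P *\<^sub>v w) \<bullet>c f)"
        using fg Pc w by (simp add: u_def cscalar_prod_smult_right cnj_cscalar_prod)
      then have "(cmod (f \<bullet>c u))\<^sup>2 = (cmod ((P *\<^sub>v w) \<bullet>c f))\<^sup>2 / s"
        using s by (simp add: norm_mult norm_divide power_divide)
      also have "\<dots> \<le> Re ((P *\<^sub>v f) \<bullet>c f)"
        using psd_mat_cauchy_schwarz[OF P fg(1) w(1)] s by (simp add: s_def field_simps)
      also have "\<dots> = vec_sq f - vec_sq (A *\<^sub>v f)"
        unfolding P_def psd_mat_defect(2)[OF A fg(1)] by simp
      finally show ?thesis .
    qed
    ultimately show ?thesis
      using fg by (auto simp: vec_sq_append intro: add_increasing2)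
  qed
  moreover have "?T \<in> carrier_mat (n + 1) (n + 1)"
    using Ac by (intro four_block_carrier_mat) auto
  ultimately have "contraction_mat (n + 1) ?T"
    by (simp add: contraction_mat_def)
  with u \<open>u \<noteq> 0\<^sub>v n\<close> show ?thesis
    by (rule that)
qed

text \<open>Conjugating the second equation gives x - i y = 0. The two equations arise from an entry
  of the upper right block and the transposed entry of the lower left block of an extension.\<close>

lemma complex_pair_zero:
  fixes x y :: complex
  assumes "x + \<i> * y = 0" "cnj x + \<i> * cnj y = 0"
  shows "x = 0" "y = 0"
  using assms by (auto simp: complex_eq_iff)

theorem arveson_boundary_spin_disk:
  assumes X: "X \<in> hermitian_pairs n"
  shows "X \<in> arveson_boundary spin_disk n \<longleftrightarrow> isometry_mat n n (to_op X)"
proof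
  assume L: "X \<in> arveson_boundary spin_disk n"
  show "isometry_mat n n (to_op X)"
  proof (rule ccontr)
    assume "\<not> isometry_mat n n (to_op X)"
    moreover have "contraction_mat n (to_op X)"
      using L by (simp add: arveson_boundary_def spin_disk_iff_contraction)
    ultimately obtain u where u: "u \<in> carrier_vec n" "u \<noteq> 0\<^sub>v n" "contraction_mat (n + 1)
      (four_block_mat (to_op X) (0\<^sub>m n 1) (mat 1 n (\<lambda>(i, j). cnj (u $ j))) (0\<^sub>m 1 1))"
      using contraction_extend_row by blast
    \<comment> \<open>The solution of \<alpha>1 + i \<alpha>2 = 0 and \<alpha>1* + i \<alpha>2* =
      u*: only the lower left block of the operator is nonzero.\<close>
    define \<alpha> where "\<alpha> = (mat n 1 (\<lambda>(i, j). u $ i / 2), mat n 1 (\<lambda>(i, j). \<i> * u $ i / 2))"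
    define \<beta> where "\<beta> = (0\<^sub>m 1 1 :: complex mat, 0\<^sub>m 1 1 :: complex mat)"
    have \<beta>: "\<beta> \<in> hermitian_pairs 1"
      by (simp add: \<beta>_def hermitian_pairs_def)
    have \<alpha>: "fst \<alpha> \<in> carrier_mat n 1" "snd \<alpha> \<in> carrier_mat n 1"
      by (auto simp: \<alpha>_def)
    have "to_op (block_pair X \<alpha> \<beta>)
        = four_block_mat (to_op X) (0\<^sub>m n 1) (mat 1 n (\<lambda>(i, j). cnj (u $ j))) (0\<^sub>m 1 1)"
      unfolding to_op_block_pair[OF X \<beta> \<alpha>]
      by (intro cong_four_block_mat) (auto simp: \<alpha>_def \<beta>_def to_op_def intro!: eq_matI)
    then have "block_pair X \<alpha> \<beta> \<in> spin_disk (n + 1)"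
      using u(3) block_pair_hermitian[OF X \<beta> \<alpha>] by (simp add: spin_disk_iff_contraction)
    moreover have "\<alpha> \<in> carrier_mat n 1 \<times> carrier_mat n 1"
      using \<alpha> by (simp add: mem_Times_iff)
    ultimately have "\<alpha> = (0\<^sub>m n 1, 0\<^sub>m n 1)"
      using L \<beta> unfolding arveson_boundary_def by blast
    then have z: "fst \<alpha> = 0\<^sub>m n 1"
      by simp
    have "u $ i = 0" if "i < n" for i
      using arg_cong[OF z, of "\<lambda>M. M $$ (i, 0)"] that by (simp add: \<alpha>_def)
    then show False
      using u(1,2) by (auto intro!: eq_vecI)
  qed
next
  assume iso: "isometry_mat n n (to_op X)"
  let ?A = "to_op X"
  have Ac: "?A \<in> carrier_mat n n"
    using X by simp
  have "X \<in> spin_disk n"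
    using X isometry_mat_contraction[OF iso] by (simp add: spin_disk_iff_contraction)
  moreover have "\<alpha> = (0\<^sub>m n m, 0\<^sub>m n m)"
    if \<alpha>: "\<alpha> \<in> carrier_mat n m \<times> carrier_mat n m" and \<beta>: "\<beta> \<in> hermitian_pairs m"
      and mem: "block_pair X \<alpha> \<beta> \<in> spin_disk (n + m)" for m \<alpha> \<beta>
  proof -
    have c: "fst \<alpha> \<in> carrier_mat n m" "snd \<alpha> \<in> carrier_mat n m"
      using \<alpha> by auto
    define p where "p = fst \<alpha> + \<i> \<cdot>\<^sub>m snd \<alpha>"
    define q where "q = mat_adjoint (fst \<alpha>) + \<i> \<cdot>\<^sub>m mat_adjoint (snd \<alpha>)"
    have pq: "p \<in> carrier_mat n m" "q \<in> carrier_mat m n"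
      using c by (auto simp: p_def q_def)
    have T: "contraction_mat (n + m) (four_block_mat ?A p q (to_op \<beta>))"
      using mem to_op_block_pair[OF X \<beta> c] by (simp add: spin_disk_iff_contraction p_def q_def)
    have q0: "q = 0\<^sub>m m n"
      using contraction_block_lower_left[OF T iso pq] \<beta> by simp
    \<comment> \<open>Passing to the adjoint moves \<open>p\<close> to the lower left. The corner
      remains isometric because a square isometry is unitary.\<close>
    have "contraction_mat (n + m)
        (four_block_mat (mat_adjoint ?A) (mat_adjoint q) (mat_adjoint p) (mat_adjoint (to_op \<beta>)))"
      using contraction_mat_adjoint[OF T] pq Ac to_op_carrier[OF \<beta>]
      by (simp add: mat_adjoint_four_block)
    from contraction_block_lower_left[OF this isometry_mat_unitary(2)[OF iso]]
    have "mat_adjoint p = 0\<^sub>m m n"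
      using pq \<beta> by simp
    then have p0: "p = 0\<^sub>m n m"
      by (metis mat_adjoint_adjoint mat_adjoint_zero)
    have "fst \<alpha> $$ (i, j) = 0" "snd \<alpha> $$ (i, j) = 0" if "i < n" "j < m" for i j
      using complex_pair_zero[of "fst \<alpha> $$ (i, j)" "snd \<alpha> $$ (i, j)"] that c
        arg_cong[OF p0, of "\<lambda>M. M $$ (i, j)"] arg_cong[OF q0, of "\<lambda>M. M $$ (j, i)"]
      by (auto simp: p_def q_def)
    then show ?thesis
      using c by (intro prod_eqI) (auto intro!: eq_matI)
  qed
  ultimately show "X \<in> arveson_boundary spin_disk n"
    unfolding arveson_boundary_def by blast
qed

text \<open>With the commutator c = X1 X2 - X2 X1, the products A* A and A A* are X1^2 + X2^2 + i c
  and X1^2 + X2^2 - i c. Both equal I exactly when c = 0 and the squares add up to I; entrywise this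
  is read off from the sum and the difference of the two equations.\<close>

lemma isometry_to_op_iff:
  assumes "X \<in> hermitian_pairs n"
  shows "isometry_mat n n (to_op X) \<longleftrightarrow> fst X * snd X = snd X * fst X \<and>
    1\<^sub>m n - fst X ^\<^sub>m 2 - snd X ^\<^sub>m 2 = 0\<^sub>m n n"
proof -
  note X = hermitian_pairsD[OF assms]
  let ?A = "to_op X"
  define p q r s where "p = fst X * fst X" and "q = snd X * snd X"
    and "r = fst X * snd X" and "s = snd X * fst X"
  have c: "p \<in> carrier_mat n n" "q \<in> carrier_mat n n" "r \<in> carrier_mat n n" "s \<in> carrier_mat n n"
    using X by (auto simp: p_def q_def r_def s_def)
  have minus: "fst X - \<i> \<cdot>\<^sub>m snd X = fst X + (- \<i>) \<cdot>\<^sub>m snd X"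
    using X by (intro eq_matI) auto
  have AA: "mat_adjoint ?A * ?A = (p + (- \<i>) \<cdot>\<^sub>m s) + \<i> \<cdot>\<^sub>m (r + (- \<i>) \<cdot>\<^sub>m q)"
    "?A * mat_adjoint ?A = (p + \<i> \<cdot>\<^sub>m s) + (- \<i>) \<cdot>\<^sub>m (r + \<i> \<cdot>\<^sub>m q)"
    unfolding mat_adjoint_to_op[OF assms] minus unfolding to_op_def p_def q_def r_def s_def using X
    by (simp_all add: mult_mat_add_left mult_mat_add_right mult_mat_smult)
  have sq: "M ^\<^sub>m 2 = M * M" if "M \<in> carrier_mat n n" for M :: "complex mat"
    using that by (simp add: numeral_2_eq_2)
  have "isometry_mat n n ?A \<longleftrightarrow> mat_adjoint ?A * ?A = 1\<^sub>m n \<and> ?A * mat_adjoint ?A = 1\<^sub>m n"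
    using isometry_mat_unitary(1)[of n ?A] assms by (auto simp: isometry_mat_def)
  also have "\<dots> \<longleftrightarrow> r = s \<and> 1\<^sub>m n - p - q = 0\<^sub>m n n"
  proof (intro iffI conjI)
    assume "mat_adjoint ?A * ?A = 1\<^sub>m n \<and> ?A * mat_adjoint ?A = 1\<^sub>m n"
    then have e: "(p + (- \<i>) \<cdot>\<^sub>m s) + \<i> \<cdot>\<^sub>m (r + (- \<i>) \<cdot>\<^sub>m q) = 1\<^sub>m n"
      "(p + \<i> \<cdot>\<^sub>m s) + (- \<i>) \<cdot>\<^sub>m (r + \<i> \<cdot>\<^sub>m q) = 1\<^sub>m n"
      unfolding AA by auto
    have *: "p $$ (i, j) + q $$ (i, j) = 1\<^sub>m n $$ (i, j) \<and> r $$ (i, j) = s $$ (i, j)" if "i < n" "j < n" for i j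
    proof -
      have "p $$ (i, j) + (- \<i>) * s $$ (i, j) + \<i> * (r $$ (i, j) + (- \<i>) * q $$ (i, j)) = 1\<^sub>m n $$ (i, j)"
        "p $$ (i, j) + \<i> * s $$ (i, j) + (- \<i>) * (r $$ (i, j) + \<i> * q $$ (i, j)) = 1\<^sub>m n $$ (i, j)"
        using arg_cong[OF e(1), of "\<lambda>M. M $$ (i, j)"] arg_cong[OF e(2), of "\<lambda>M. M $$ (i, j)"] that c
        by (simp_all add: algebra_simps del: index_one_mat(1))
      then show ?thesis
        by (auto simp: complex_eq_iff)
    qed
    show "r = s"
      using * c by (intro eq_matI) auto
    show "1\<^sub>m n - p - q = 0\<^sub>m n n"
    proof (intro eq_matI)
      fix i j assume "i < dim_row (0\<^sub>m n n :: complex mat)" "j < dim_col (0\<^sub>m n n :: complex mat)"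
      then show "(1\<^sub>m n - p - q) $$ (i, j) = 0\<^sub>m n n $$ (i, j)"
        using *[of i j] c by (simp add: algebra_simps del: index_one_mat(1))
    qed (use c in auto)
  next
    assume e: "r = s \<and> 1\<^sub>m n - p - q = 0\<^sub>m n n"
    have *: "p $$ (i, j) + q $$ (i, j) = 1\<^sub>m n $$ (i, j)" if "i < n" "j < n" for i j
      using arg_cong[OF conjunct2[OF e], of "\<lambda>M. M $$ (i, j)"] that c
      by (simp add: algebra_simps del: index_one_mat(1))
    show "mat_adjoint ?A * ?A = 1\<^sub>m n" "?A * mat_adjoint ?A = 1\<^sub>m n"
      unfolding AA using c e * by (auto simp: algebra_simps simp del: index_one_mat(1) intro!: eq_matI)
  qed
  finally show ?thesis
    using X by (simp add: sq p_def q_def r_def s_def)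
qed

theorem matrix_convex_hull_arveson_boundary:
  "matrix_convex_hull (arveson_boundary spin_disk) = spin_disk"
proof (rule antisym)
  show "matrix_convex_hull (arveson_boundary spin_disk) \<le> spin_disk"
    by (rule matrix_convex_hull_least[OF matrix_convex_spin_disk])
      (auto simp: le_fun_def arveson_boundary_def)
  have "X \<in> K n" if X: "X \<in> spin_disk n" and K: "matrix_convex K" "arveson_boundary spin_disk \<le> K" for X n K
  proof -
    have Xh: "X \<in> hermitian_pairs n" "contraction_mat n (to_op X)" and n: "0 < n"
      using X hermitian_pairsD(1)[of X n] by (auto simp: spin_disk_iff_contraction)
    obtain U where U: "isometry_mat (n + n) (n + n) U"
      "mat_adjoint (corner_mat (n + n) n) * U * corner_mat (n + n) n = to_op X"
      by (rule contraction_unitary_dilation[OF Xh(2)])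
    have Uc: "U \<in> carrier_mat (n + n) (n + n)"
      using U(1) by (simp add: isometry_mat_def)
    have Y: "of_op U \<in> hermitian_pairs (n + n)"
      using Uc n by (simp add: of_op_hermitian)
    \<comment> \<open>The pair of a unitary lies in the Arveson boundary, which \<open>K\<close>
      contains at every level, in particular at level 2n.\<close>
    have "of_op U \<in> K (n + n)"
      using U(1) Y K(2) arveson_boundary_spin_disk[OF Y] by (auto simp: to_op_of_op[OF Uc] le_fun_def)
    then have "compress (corner_mat (n + n) n) (of_op U) \<in> K n"
      using K(1) n isometry_corner_mat[of n "n + n"] unfolding matrix_convex_def
      by (metis One_nat_def Suc_leI le_add1)
    moreover have "compress (corner_mat (n + n) n) (of_op U) = X"
      using Y Xh n U(2)
      by (intro to_op_inject[OF compress_hermitian[OF Y] Xh(1)])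
        (simp_all add: to_op_compress[OF Y corner_mat_carrier] to_op_of_op[OF Uc])
    ultimately show ?thesis
      by simp
  qed
  then show "spin_disk \<le> matrix_convex_hull (arveson_boundary spin_disk)"
    unfolding matrix_convex_hull_def by (auto simp: le_fun_def)
qed


section \<open>Absolute extreme points\<close>

text \<open>The squared norm of B v - a v is at most twice the difference of the two sides of the
  inequality, so equality makes this vector vanish.\<close>

lemma contraction_eigenvector:
  assumes B: "contraction_mat n B" and v: "v \<in> carrier_vec n" and a: "cmod a = 1"
  shows "Re (cnj a * ((B *\<^sub>v v) \<bullet>c v)) \<le> vec_sq v"
    and "Re (cnj a * ((B *\<^sub>v v) \<bullet>c v)) = vec_sq v \<Longrightarrow> B *\<^sub>v v = a \<cdot>\<^sub>v v"
proof -
  have Bc: "B \<in> carrier_mat n n"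
    using B by (simp add: contraction_mat_def)
  let ?d = "B *\<^sub>v v + (- a) \<cdot>\<^sub>v v"
  have d: "?d \<in> carrier_vec n"
    using Bc v by simp
  define t where "t = Re (cnj a * ((B *\<^sub>v v) \<bullet>c v))"
  have "vec_sq ?d = vec_sq (B *\<^sub>v v) + vec_sq v - 2 * t"
    unfolding t_def using Bc v a by (simp add: vec_sq_add vec_sq_smult cscalar_prod_smult_right)
  moreover have "vec_sq (B *\<^sub>v v) \<le> vec_sq v"
    using B v by (simp add: contraction_mat_def)
  ultimately have le: "vec_sq ?d \<le> 2 * (vec_sq v - t)"
    by simp
  show "Re (cnj a * ((B *\<^sub>v v) \<bullet>c v)) \<le> vec_sq v"
    unfolding t_def[symmetric] using order_trans[OF vec_sq_nonneg le] by simp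
  assume "Re (cnj a * ((B *\<^sub>v v) \<bullet>c v)) = vec_sq v"
  then have "vec_sq ?d = 0"
    unfolding t_def[symmetric] using le by (intro order_antisym vec_sq_nonneg) simp
  then have *: "?d = 0\<^sub>v n"
    using vec_sq_eq_0_iff[OF d] by simp
  show "B *\<^sub>v v = a \<cdot>\<^sub>v v"
  proof (intro eq_vecI)
    fix i assume "i < dim_vec (a \<cdot>\<^sub>v v)"
    then show "(B *\<^sub>v v) $ i = (a \<cdot>\<^sub>v v) $ i"
      using arg_cong[OF *, of "\<lambda>x. x $ i"] Bc v by (simp del: index_mult_mat_vec)
  qed (use Bc v in auto)
qed

text \<open>The adjoint is a contraction too, and its form at v attains the extreme value for the
  conjugate of a, so the equality case applies a second time. Hence the line through v reduces
  B.\<close>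

lemma contraction_eigenvector_adjoint:
  assumes B: "contraction_mat n B" and v: "v \<in> carrier_vec n" and a: "cmod a = 1"
    and eq: "B *\<^sub>v v = a \<cdot>\<^sub>v v"
  shows "mat_adjoint B *\<^sub>v v = cnj a \<cdot>\<^sub>v v"
proof (rule contraction_eigenvector(2)[OF contraction_mat_adjoint[OF B] v])
  have Bc: "B \<in> carrier_mat n n"
    using B by (simp add: contraction_mat_def)
  have "(mat_adjoint B *\<^sub>v v) \<bullet>c v = v \<bullet>c (a \<cdot>\<^sub>v v)"
    using cscalar_prod_mult_mat_vec[of "mat_adjoint B" n n v v] Bc v eq by simp
  also have "\<dots> = cnj a * of_real (vec_sq v)"
    by (simp add: cscalar_prod_smult_right cscalar_prod_self)
  finally have "cnj (cnj a) * ((mat_adjoint B *\<^sub>v v) \<bullet>c v) = a * cnj a * of_real (vec_sq v)"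
    by simp
  also have "a * cnj a = 1"
    using a complex_norm_square[of a] by simp
  finally show "Re (cnj (cnj a) * ((mat_adjoint B *\<^sub>v v) \<bullet>c v)) = vec_sq v"
    by simp
qed (use a in simp)

section \<open>Level one as the closed unit disk\<close>

lemma scalar_pair_hermitian: "scalar_pair p \<in> hermitian_pairs 1"
  by (auto simp: scalar_pair_def hermitian_pairs_def intro!: eq_matI)

lemma to_op_scalar_pair: "to_op (scalar_pair p) = mat 1 1 (\<lambda>_. Complex (fst p) (snd p))"
  by (intro eq_matI) (auto simp: scalar_pair_def to_op_def complex_eq_iff)

lemma contraction_mat_1: "contraction_mat 1 (mat 1 1 (\<lambda>_. a)) \<longleftrightarrow> cmod a \<le> 1"
proof -
  have *: "mat 1 1 (\<lambda>_. a) *\<^sub>v v = a \<cdot>\<^sub>v v" if "v \<in> carrier_vec 1" for v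
    using that by (intro eq_vecI) (auto simp: scalar_prod_def)
  show ?thesis
  proof
    assume "contraction_mat 1 (mat 1 1 (\<lambda>_. a))"
    then have "vec_sq (a \<cdot>\<^sub>v unit_vec 1 0) \<le> vec_sq (unit_vec 1 0)"
      by (metis * contraction_mat_def unit_vec_carrier)
    moreover have "vec_sq (unit_vec 1 0) = 1"
      by (simp add: vec_sq_def cscalar_prod_unit_vec)
    ultimately show "cmod a \<le> 1"
      by (simp add: vec_sq_smult power_le_one_iff)
  next
    assume "cmod a \<le> 1"
    then have "(cmod a)\<^sup>2 * vec_sq v \<le> vec_sq v" for v
      by (simp add: mult_left_le_one_le power_le_one)
    then show "contraction_mat 1 (mat 1 1 (\<lambda>_. a))"
      using * by (auto simp: contraction_mat_def vec_sq_smult simp del: One_nat_def)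
  qed
qed

lemma scalar_pair_spin_disk: "scalar_pair p \<in> spin_disk 1 \<longleftrightarrow> norm p \<le> 1"
  using contraction_mat_1
  by (cases p) (simp add: spin_disk_iff_contraction scalar_pair_hermitian[unfolded One_nat_def]
      to_op_scalar_pair[unfolded One_nat_def] norm_Pair cmod_def)

lemma extreme_points_level_one_spin_disk: "{p. p extreme_point_of level_one spin_disk} = sphere 0 1"
proof -
  have eq: "level_one spin_disk = cball 0 1"
    using scalar_pair_spin_disk by (auto simp: level_one_def)
  show ?thesis
    unfolding eq
  proof (intro equalityI subsetI)
    fix p :: "real \<times> real" assume "p \<in> {p. p extreme_point_of cball 0 1}"
    then have "p \<in> cball 0 1" "p \<notin> interior (cball 0 1)"
      using extreme_point_not_in_interior[of p "cball 0 1"] by (auto simp: extreme_point_of_def)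
    then show "p \<in> sphere 0 1"
      by simp
  next
    fix p :: "real \<times> real" assume p: "p \<in> sphere 0 1"
    \<comment> \<open>Strict convexity: a point inside a segment is strictly closer to the centre
      than one of the endpoints.\<close>
    have "p \<notin> open_segment a b" if "a \<in> cball 0 1" "b \<in> cball 0 1" for a b
      using dist_decreases_open_segment[of p a b 0] that p by auto
    then show "p \<in> {p. p extreme_point_of cball 0 1}"
      using p by (simp add: extreme_point_of_def)
  qed
qed

text \<open>The weights \<open>4/5\<close> and \<open>2/5\<close> satisfy \<open>(4/5)\<^sup>2 + (1 - 2/5)\<^sup>2 = 1\<close>; they keep \<open>P\<close> nonzero even
  in dimension one, where the projection \<open>I - v v\<^sup>*\<close> would vanish.\<close>

lemma eigenvector_splitting:
  assumes M: "M \<in> carrier_mat n n" "mat_adjoint M = M" and v: "v \<in> carrier_vec n" "vec_sq v = 1"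
    and eq: "M *\<^sub>v v = complex_of_real r \<cdot>\<^sub>v v"
  defines "R \<equiv> mat 1 n (\<lambda>(i, j). 4 / 5 * cnj (v $ j))"
  defines "P \<equiv> mat n n (\<lambda>(i, j). (if i = j then 1 else 0) - 2 / 5 * v $ i * cnj (v $ j))"
  shows "mat_adjoint R * mat 1 1 (\<lambda>_. complex_of_real r) * R + mat_adjoint P * M * P = M"
proof (rule mat_eqI_mult_mat_vec[of _ n n])
  fix f :: "complex vec" assume f: "f \<in> carrier_vec n"
  have Rc: "R \<in> carrier_mat 1 n" and Pc: "P \<in> carrier_mat n n" "mat_adjoint P = P"
    by (auto simp: R_def P_def intro!: eq_matI)
  let ?c = "f \<bullet>c v"
  have Pf: "P *\<^sub>v g = g + (- (2 / 5) * (g \<bullet>c v)) \<cdot>\<^sub>v v" if g: "g \<in> carrier_vec n" for g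
  proof (intro eq_vecI)
    fix i assume "i < dim_vec (g + (- (2 / 5) * (g \<bullet>c v)) \<cdot>\<^sub>v v)"
    then have i: "i < n"
      using v by simp
    have "(P *\<^sub>v g) $ i = (\<Sum>j<n. (if i = j then g $ j else 0) - 2 / 5 * v $ i * (g $ j * cnj (v $ j)))"
      using i g by (auto simp: P_def scalar_prod_def atLeast0LessThan algebra_simps intro!: sum.cong)
    also have "\<dots> = g $ i - 2 / 5 * v $ i * (g \<bullet>c v)"
      using i v by (simp add: sum_subtractf sum_distrib_left scalar_prod_def atLeast0LessThan)
    finally show "(P *\<^sub>v g) $ i = (g + (- (2 / 5) * (g \<bullet>c v)) \<cdot>\<^sub>v v) $ i"
      using i g v by simp
  qed (use g v Pc in auto)
  have Mf: "(M *\<^sub>v f) \<bullet>c v = of_real r * ?c"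
    using cscalar_prod_mult_mat_vec[OF M(1) f v(1)] M(2) eq f v by (simp add: cscalar_prod_smult_right)
  have MPf: "M *\<^sub>v (P *\<^sub>v f) = M *\<^sub>v f + (- (2 / 5) * ?c * of_real r) \<cdot>\<^sub>v v"
    using M f v Pf[OF f] by (simp add: mult_mat_vec_simps eq smult_smult_assoc)
  \<comment> \<open>\<open>P\<close> multiplies the component along v by 3/5, so conjugation keeps
    9/25 of the eigenvalue part. The missing 16/25 is what the term with \<open>R\<close>, of weight
    4/5, restores.\<close>
  have PMPf: "P *\<^sub>v (M *\<^sub>v (P *\<^sub>v f)) = M *\<^sub>v f + (- (16 / 25) * of_real r * ?c) \<cdot>\<^sub>v v"
  proof -
    have "(M *\<^sub>v (P *\<^sub>v f)) \<bullet>c v = 3 / 5 * of_real r * ?c"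
      unfolding MPf using M f v by (simp add: cscalar_prod_simps Mf cscalar_prod_self algebra_simps)
    moreover have "M *\<^sub>v (P *\<^sub>v f) \<in> carrier_vec n"
      using M Pc f by simp
    ultimately have "P *\<^sub>v (M *\<^sub>v (P *\<^sub>v f)) = M *\<^sub>v (P *\<^sub>v f) + (- (2 / 5) * (3 / 5 * of_real r * ?c)) \<cdot>\<^sub>v v"
      using Pf by presburger
    then show ?thesis
      unfolding MPf using M v by (intro eq_vecI) (auto simp: algebra_simps simp del: index_mult_mat_vec)
  qed
  have R1: "mat_adjoint R *\<^sub>v (mat 1 1 (\<lambda>_. complex_of_real r) *\<^sub>v (R *\<^sub>v f)) = (16 / 25 * of_real r * ?c) \<cdot>\<^sub>v v"
  proof -
    have "R *\<^sub>v f = vec 1 (\<lambda>_. 4 / 5 * ?c)"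
      using f v by (intro eq_vecI) (auto simp: R_def scalar_prod_def sum_distrib_left mult_ac)
    moreover have "mat_adjoint R *\<^sub>v (mat 1 1 (\<lambda>_. complex_of_real r) *\<^sub>v vec 1 (\<lambda>_. 4 / 5 * ?c))
        = (16 / 25 * of_real r * ?c) \<cdot>\<^sub>v v"
      using v by (intro eq_vecI) (auto simp: R_def scalar_prod_def)
    ultimately show ?thesis
      by simp
  qed
  have "(mat_adjoint R * mat 1 1 (\<lambda>_. complex_of_real r) * R + mat_adjoint P * M * P) *\<^sub>v f
      = (16 / 25 * of_real r * ?c) \<cdot>\<^sub>v v + P *\<^sub>v (M *\<^sub>v (P *\<^sub>v f))"
    unfolding R1[symmetric] using Rc Pc M f by (simp add: add_mat_mult_vec mult_mat_mat_vec)
  also have "\<dots> = M *\<^sub>v f"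
    unfolding PMPf using M v by (intro eq_vecI) (auto simp del: index_mult_mat_vec)
  finally show "(mat_adjoint R * mat 1 1 (\<lambda>_. complex_of_real r) * R + mat_adjoint P * M * P) *\<^sub>v f = M *\<^sub>v f" .
qed (auto simp: R_def P_def M)


section \<open>Eigenvectors and the dimension of absolute extreme points\<close>

lemma unit_eigenvector_exists:
  assumes A: "A \<in> carrier_mat n n" and "0 < n"
  obtains a v where "v \<in> carrier_vec n" "vec_sq v = 1" "A *\<^sub>v v = a \<cdot>\<^sub>v v"
proof -
  obtain a where "eigenvalue A a"
    using spectrum_non_empty[OF A \<open>0 < n\<close>] by (auto simp: spectrum_def)
  then obtain x where x: "x \<in> carrier_vec n" "x \<noteq> 0\<^sub>v n" "A *\<^sub>v x = a \<cdot>\<^sub>v x"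
    using A by (auto simp: eigenvalue_def eigenvector_def)
  define v where "v = complex_of_real (1 / sqrt (vec_sq x)) \<cdot>\<^sub>v x"
  have "vec_sq v = 1"
    using vec_sq_eq_0_iff[OF x(1)] x(2) by (simp add: v_def vec_sq_smult norm_divide power_divide)
  moreover have "A *\<^sub>v v = a \<cdot>\<^sub>v v"
    using A x by (simp add: v_def mult_mat_smult_vec smult_smult_assoc mult.commute)
  moreover have "v \<in> carrier_vec n"
    using x by (simp add: v_def)
  ultimately show ?thesis
    using that by blast
qed

text \<open>Half the sum of the two eigenvalue equations concerns X1 and their difference over 2 i
  concerns X2. A common eigenvector of A and its adjoint is thus a joint eigenvector of the pair,
  with real eigenvalues.\<close>

lemma eigenvector_coordinates:
  assumes X: "X \<in> hermitian_pairs n" and v: "v \<in> carrier_vec n"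
    and eq: "to_op X *\<^sub>v v = a \<cdot>\<^sub>v v" "mat_adjoint (to_op X) *\<^sub>v v = cnj a \<cdot>\<^sub>v v"
  shows "fst X *\<^sub>v v = complex_of_real (Re a) \<cdot>\<^sub>v v" "snd X *\<^sub>v v = complex_of_real (Im a) \<cdot>\<^sub>v v"
proof -
  note Xd = hermitian_pairsD[OF X]
  have "(fst X *\<^sub>v v) $ i + \<i> * (snd X *\<^sub>v v) $ i = a * v $ i"
    "(fst X *\<^sub>v v) $ i - \<i> * (snd X *\<^sub>v v) $ i = cnj a * v $ i" if "i < n" for i
  proof -
    have "to_op X *\<^sub>v v = fst X *\<^sub>v v + \<i> \<cdot>\<^sub>v (snd X *\<^sub>v v)"
      "mat_adjoint (to_op X) *\<^sub>v v = fst X *\<^sub>v v - \<i> \<cdot>\<^sub>v (snd X *\<^sub>v v)"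
      unfolding mat_adjoint_to_op[OF X] unfolding to_op_def using Xd v
      by (simp_all add: mult_mat_vec_simps)
    then show "(fst X *\<^sub>v v) $ i + \<i> * (snd X *\<^sub>v v) $ i = a * v $ i"
      "(fst X *\<^sub>v v) $ i - \<i> * (snd X *\<^sub>v v) $ i = cnj a * v $ i"
      using arg_cong[OF eq(1), of "\<lambda>x. x $ i"] arg_cong[OF eq(2), of "\<lambda>x. x $ i"] Xd v that
      by (simp_all del: index_mult_mat_vec)
  qed
  note * = this
  have **: "x = of_real (Re a) * z" "y = of_real (Im a) * z"
    if "x + \<i> * y = a * z" "x - \<i> * y = cnj a * z" for x y z
  proof -
    have "2 * x = (a + cnj a) * z" "2 * \<i> * y = (a - cnj a) * z"
      using that by (auto simp: algebra_simps)
    then show "x = of_real (Re a) * z" "y = of_real (Im a) * z"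
      by (simp_all add: complex_add_cnj complex_diff_cnj)
  qed
  show "fst X *\<^sub>v v = complex_of_real (Re a) \<cdot>\<^sub>v v" "snd X *\<^sub>v v = complex_of_real (Im a) \<cdot>\<^sub>v v"
    using Xd v **[OF *] by (auto intro!: eq_vecI simp del: index_mult_mat_vec)
qed

lemma mat_sum_1: "F 0 \<in> carrier_mat n n \<Longrightarrow> mat_sum n F 1 = F 0"
  by (intro eq_matI) (auto simp: mat_sum_def)

lemma mat_sum_2:
  "F 0 \<in> carrier_mat n n \<Longrightarrow> F 1 \<in> carrier_mat n n \<Longrightarrow> mat_sum n F 2 = F 0 + F 1"
  by (intro eq_matI) (auto simp: mat_sum_def numeral_2_eq_2)

lemma absolute_extreme_pointD:
  fixes N :: nat and k :: "nat \<Rightarrow> nat" and Y :: "nat \<Rightarrow> cpair" and V :: "nat \<Rightarrow> complex mat"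
  assumes "X \<in> absolute_extreme_points K n"
    "\<And>l. l < N \<Longrightarrow> Y l \<in> K (k l)" "\<And>l. l < N \<Longrightarrow> V l \<in> carrier_mat (k l) n"
    "\<And>l. l < N \<Longrightarrow> V l \<noteq> 0\<^sub>m (k l) n"
    "mat_sum n (\<lambda>l. mat_adjoint (V l) * V l) N = 1\<^sub>m n"
    "fst X = mat_sum n (\<lambda>l. fst (compress (V l) (Y l))) N"
    "snd X = mat_sum n (\<lambda>l. snd (compress (V l) (Y l))) N" "l < N"
  shows "k l \<le> n \<and> unitarily_equiv n X (Y l) \<or> n < k l \<and>
    (\<exists>Z \<in> K (k l - n). unitarily_equiv (k l) (Y l) (direct_sum_pair n (k l - n) X Z))"
proof -
  have "X = (mat_sum n (\<lambda>l. fst (compress (V l) (Y l))) N, mat_sum n (\<lambda>l. snd (compress (V l) (Y l))) N)"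
    using assms(6,7) by (intro prod_eqI) auto
  then show ?thesis
    using assms(1-5,8) unfolding absolute_extreme_points_def by blast
qed

text \<open>The corner embedding alone is an admissible combination, with the unitary dilation Y as
  its only point. Since Y has size 2n, the alternative for size at most n is excluded, and Y is
  equivalent to a direct sum that contains X; a summand of a unitary is unitary.\<close>

lemma absolute_extreme_point_isometry:
  assumes X: "X \<in> absolute_extreme_points spin_disk n"
  shows "isometry_mat n n (to_op X)"
proof -
  have "X \<in> spin_disk n"
    using X by (simp add: absolute_extreme_points_def)
  then have Xh: "X \<in> hermitian_pairs n" "contraction_mat n (to_op X)" and n: "0 < n"
    using hermitian_pairsD(1)[of X n] by (auto simp: spin_disk_iff_contraction)
  let ?J = "corner_mat (n + n) n"
  obtain U where U: "isometry_mat (n + n) (n + n) U" "mat_adjoint ?J * U * ?J = to_op X"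
    by (rule contraction_unitary_dilation[OF Xh(2)])
  have Uc: "U \<in> carrier_mat (n + n) (n + n)"
    using U(1) by (simp add: isometry_mat_def)
  define Y where "Y = of_op U"
  have Y: "Y \<in> hermitian_pairs (n + n)" "to_op Y = U"
    using Uc n by (auto simp: Y_def of_op_hermitian to_op_of_op)
  have YD: "Y \<in> spin_disk (n + n)"
    using Y isometry_mat_contraction[OF U(1)] by (simp add: spin_disk_iff_contraction)
  have XY: "compress ?J Y = X"
    using Xh n U(2) Y(2)
    by (intro to_op_inject[OF compress_hermitian[OF Y(1)] Xh(1)])
      (simp_all add: to_op_compress[OF Y(1) corner_mat_carrier])
  have J: "mat_adjoint ?J * ?J = 1\<^sub>m n"
    using isometry_corner_mat[of n "n + n"] by (simp add: isometry_mat_def)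
  have J0: "?J \<noteq> 0\<^sub>m (n + n) n"
  proof
    assume "?J = 0\<^sub>m (n + n) n"
    then have "?J $$ (0, 0) = 0"
      using n by simp
    then show False
      using n by (simp add: corner_mat_def)
  qed
  have "n + n \<le> n \<and> unitarily_equiv n X Y \<or> n < n + n \<and>
    (\<exists>Z \<in> spin_disk (n + n - n). unitarily_equiv (n + n) Y (direct_sum_pair n (n + n - n) X Z))"
  proof (rule absolute_extreme_pointD[OF X, where N = 1 and V = "\<lambda>_. ?J" and Y = "\<lambda>_. Y"
        and k = "\<lambda>_. n + n" and l = 0])
    show "mat_sum n (\<lambda>l. mat_adjoint ?J * ?J) 1 = 1\<^sub>m n"
      unfolding J by (rule mat_sum_1) simp
    show "fst X = mat_sum n (\<lambda>l. fst (compress ?J Y)) 1" "snd X = mat_sum n (\<lambda>l. snd (compress ?J Y)) 1"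
      unfolding XY using hermitian_pairsD[OF Xh(1)] by (simp_all add: mat_sum_1[simplified])
  qed (use YD J0 in auto)
  then obtain Z where Z: "Z \<in> spin_disk n" "unitarily_equiv (n + n) Y (direct_sum_pair n n X Z)"
    using n by auto
  then have Zh: "Z \<in> hermitian_pairs n"
    by (simp add: spin_disk_iff_contraction)
  obtain W where W: "unitary_mat (n + n) W" "direct_sum_pair n n X Z = compress W Y"
    using Z(2) by (auto simp: unitarily_equiv_def)
  have Wc: "W \<in> carrier_mat (n + n) (n + n)" and Wi: "isometry_mat (n + n) (n + n) W"
    using W(1) by (auto simp: unitary_mat_def isometry_mat_def)
  let ?T = "four_block_mat (to_op X) (0\<^sub>m n n) (0\<^sub>m n n) (to_op Z)"
  have T: "?T = mat_adjoint W * U * W"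
    using to_op_direct_sum_pair[OF Xh(1) Zh] to_op_compress[OF Y(1) Wc] W(2) Y(2) by simp
  show ?thesis
  proof -
    \<comment> \<open>Conjugation by \<open>W\<close> keeps the unitary \<open>U\<close> unitary;
      since \<open>?T\<close> is block diagonal, the upper left block of the identity speaks of
      \<open>X\<close> alone.\<close>
    have "mat_adjoint ?T * ?T = 1\<^sub>m (n + n)"
    proof -
      have "mat_adjoint ?T * ?T = mat_adjoint W * (mat_adjoint U * (W * mat_adjoint W) * U) * W"
        unfolding T using Wc Uc by (simp add: mat_adjoint_mult mult_mat_assoc)
      also have "\<dots> = 1\<^sub>m (n + n)"
        using W(1) U(1) Wc Uc by (simp add: unitary_mat_def isometry_mat_def)
      finally show ?thesis .
    qed
    moreover have "mat_adjoint ?T * ?T = four_block_mat (mat_adjoint (to_op X) * to_op X) (0\<^sub>m n n)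
        (0\<^sub>m n n) (mat_adjoint (to_op Z) * to_op Z)"
    proof -
      have "mat_adjoint (to_op X) * to_op X \<in> carrier_mat n n"
        "mat_adjoint (to_op Z) * to_op Z \<in> carrier_mat n n"
        by (rule mult_carrier_mat[of _ n n]; use to_op_carrier[OF Xh(1)] to_op_carrier[OF Zh] in simp)+
      then show ?thesis
        using to_op_carrier[OF Xh(1)] to_op_carrier[OF Zh]
        by (simp add: mat_adjoint_four_block mult_four_block_mat[of _ n n _ n _ n _ _ n _ n])
    qed
    ultimately have *: "four_block_mat (mat_adjoint (to_op X) * to_op X) (0\<^sub>m n n)
        (0\<^sub>m n n) (mat_adjoint (to_op Z) * to_op Z) = 1\<^sub>m (n + n)"
      by simp
    have "mat_adjoint (to_op X) * to_op X = 1\<^sub>m n"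
    proof (intro eq_matI)
      fix i j assume "i < dim_row (1\<^sub>m n :: complex mat)" "j < dim_col (1\<^sub>m n :: complex mat)"
      then show "(mat_adjoint (to_op X) * to_op X) $$ (i, j) = 1\<^sub>m n $$ (i, j)"
        using arg_cong[OF *, of "\<lambda>M. M $$ (i, j)"] to_op_carrier[OF Xh(1)]
          carrier_matD[OF to_op_carrier[OF Zh]]
        by (simp del: index_mult_mat(1))
    qed (use to_op_carrier[OF Xh(1)] in auto)
    then show ?thesis
      using Xh(1) by (simp add: isometry_mat_def)
  qed
qed

text \<open>X is a combination of the 1 by 1 point of its eigenvalue, through R, and of X itself,
  through P. As 1 \<le> n, the property requires the 1 by 1 point to be unitarily equivalent to X at
  level n, which is possible only for n = 1.\<close>

lemma absolute_extreme_point_level: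
  assumes X: "X \<in> absolute_extreme_points spin_disk n"
  shows "n = 1"
proof -
  have XD: "X \<in> spin_disk n"
    using X by (simp add: absolute_extreme_points_def)
  then have Xh: "X \<in> hermitian_pairs n" "contraction_mat n (to_op X)" and n: "0 < n"
    using hermitian_pairsD(1)[of X n] by (auto simp: spin_disk_iff_contraction)
  note Xd = hermitian_pairsD[OF Xh(1)]
  note iso = absolute_extreme_point_isometry[OF X]
  obtain a v where v: "v \<in> carrier_vec n" "vec_sq v = 1" "to_op X *\<^sub>v v = a \<cdot>\<^sub>v v"
    by (rule unit_eigenvector_exists[OF to_op_carrier[OF Xh(1)] n])
  \<comment> \<open>An isometry preserves the norm of its eigenvector, so the eigenvalue is
    unimodular; this is what makes \<open>v\<close> an eigenvector of the adjoint as well.\<close>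
  have a: "cmod a = 1"
    using vec_sq_isometry[OF iso v(1)] v(2) unfolding v(3) vec_sq_smult
    by (simp add: power2_eq_1_iff) (metis norm_ge_zero not_one_le_zero le_minus_one_simps(3))
  note coords = eigenvector_coordinates[OF Xh(1) v(1,3)
      contraction_eigenvector_adjoint[OF Xh(2) v(1) a v(3)]]
  define R where "R = mat 1 n (\<lambda>(i, j). 4 / 5 * cnj (v $ j))"
  define P where "P = mat n n (\<lambda>(i, j). (if i = j then 1 else 0) - 2 / 5 * v $ i * cnj (v $ j))"
  note split = eigenvector_splitting[OF _ _ v(1,2), folded R_def P_def]
  have c: "R \<in> carrier_mat 1 n" "P \<in> carrier_mat n n"
    by (auto simp: R_def P_def)
  have one: "mat 1 1 (\<lambda>_. 1) = (1\<^sub>m 1 :: complex mat)"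
    by (intro eq_matI) auto
  \<comment> \<open>The splitting identity serves three times: for the identity matrix with r = 1 it
    gives the partition of unity, and for the two coordinates of \<open>X\<close> it gives the
    combination itself.\<close>
  have unity: "mat_adjoint R * R + mat_adjoint P * P = 1\<^sub>m n"
    using split[of "1\<^sub>m n" 1] v(1) c by (simp add: one[unfolded One_nat_def])
  let ?p = "scalar_pair (Re a, Im a)"
  have sum: "fst (compress R ?p) + fst (compress P X) = fst X"
    "snd (compress R ?p) + snd (compress P X) = snd X"
    using split[OF Xd(2,4) coords(1)] split[OF Xd(3,5) coords(2)]
    by (simp_all add: compress_def scalar_pair_def)
  have cc: "fst (compress R ?p) \<in> carrier_mat n n" "snd (compress R ?p) \<in> carrier_mat n n"
    "fst (compress P X) \<in> carrier_mat n n" "snd (compress P X) \<in> carrier_mat n n"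
    using compress_hermitian[OF scalar_pair_hermitian c(1) n] compress_hermitian[OF Xh(1) c(2) n]
    by (simp_all add: hermitian_pairsD)
  have p: "?p \<in> spin_disk 1"
    unfolding scalar_pair_spin_disk using a by (simp add: norm_Pair cmod_def)
  have nz: "R \<noteq> 0\<^sub>m 1 n" "P \<noteq> 0\<^sub>m n n"
  proof -
    have v0: "v \<noteq> 0\<^sub>v n"
      using v(2) by auto
    show "R \<noteq> 0\<^sub>m 1 n"
    proof
      assume R0: "R = 0\<^sub>m 1 n"
      have "v $ j = 0" if "j < n" for j
        using arg_cong[OF R0, of "\<lambda>M. M $$ (0, j)"] that by (simp add: R_def)
      then show False
        using v0 v(1) by (auto intro!: eq_vecI)
    qed
    show "P \<noteq> 0\<^sub>m n n"
    proof
      \<comment> \<open>Then \<open>R\<close> alone would be an isometry, although it maps the unit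
        vector \<open>v\<close> to a vector of norm 4/5.\<close>
      assume "P = 0\<^sub>m n n"
      then have unity': "mat_adjoint R * R = 1\<^sub>m n"
        using unity c right_add_zero_mat[OF mult_carrier_mat[OF mat_adjoint_carrier[OF c(1)] c(1)]]
        by simp
      have "isometry_mat 1 n R"
        using c unity' by (simp add: isometry_mat_def)
      from vec_sq_isometry[OF this v(1)] have "vec_sq (R *\<^sub>v v) = 1"
        using v(2) by simp
      moreover have "R *\<^sub>v v = vec 1 (\<lambda>_. 4 / 5 * (v \<bullet>c v))"
        using v(1) by (intro eq_vecI) (auto simp: R_def scalar_prod_def sum_distrib_left mult_ac)
      ultimately show False
        by (simp only: vec_sq_vec_1 cscalar_prod_self v(2)) (simp add: power2_eq_square)
    qed
  qed
  have "1 \<le> n \<and> unitarily_equiv n X ?p \<or> n < 1 \<and>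
    (\<exists>Z \<in> spin_disk (1 - n). unitarily_equiv 1 ?p (direct_sum_pair n (1 - n) X Z))"
  proof -
    let ?V = "\<lambda>l :: nat. if l = 0 then R else P"
    let ?Y = "\<lambda>l :: nat. if l = 0 then ?p else X"
    let ?k = "\<lambda>l :: nat. if l = 0 then 1 else n"
    have "?k 0 \<le> n \<and> unitarily_equiv n X (?Y 0) \<or> n < ?k 0 \<and>
      (\<exists>Z \<in> spin_disk (?k 0 - n). unitarily_equiv (?k 0) (?Y 0) (direct_sum_pair n (?k 0 - n) X Z))"
    proof (rule absolute_extreme_pointD[OF X, where N = 2 and V = ?V and Y = ?Y and k = ?k and l = 0])
      show "mat_sum n (\<lambda>l. mat_adjoint (?V l) * ?V l) 2 = 1\<^sub>m n"
        using c unity mult_carrier_mat[OF mat_adjoint_carrier[OF c(1)] c(1)]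
          mult_carrier_mat[OF mat_adjoint_carrier[OF c(2)] c(2)] by (subst mat_sum_2) auto
      show "fst X = mat_sum n (\<lambda>l. fst (compress (?V l) (?Y l))) 2"
        using cc sum by (subst mat_sum_2) auto
      show "snd X = mat_sum n (\<lambda>l. snd (compress (?V l) (?Y l))) 2"
        using cc sum by (subst mat_sum_2) auto
    qed (use p XD c nz in auto)
    then show ?thesis
      by simp
  qed
  then have "?p \<in> hermitian_pairs n"
    using n by (auto simp: unitarily_equiv_def)
  then show ?thesis
    using hermitian_pairsD(2) by (fastforce simp: scalar_pair_def)
qed


text \<open>With a single column v for each coefficient, the combination averages values of
  quadratic forms. Being on the circle forces equality in every term, so each v is a reducing
  eigenvector for a. In an orthonormal basis that starts with v, the point Y splits into the scalar
  a and a rest Z; the rest is empty exactly at level one, which matches the two alternatives of the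
  definition.\<close>

lemma scalar_pair_absolute_extreme:
  assumes p: "norm p = 1"
  shows "scalar_pair p \<in> absolute_extreme_points spin_disk 1"
proof -
  define a where "a = Complex (fst p) (snd p)"
  have a: "cmod a = 1"
    using p by (cases p) (simp add: a_def norm_Pair cmod_def)
  define X where "X = scalar_pair p"
  have X: "X \<in> spin_disk 1" "X \<in> hermitian_pairs 1" "to_op X = mat 1 1 (\<lambda>_. a)"
    unfolding X_def using p scalar_pair_spin_disk scalar_pair_hermitian
    by (auto simp: to_op_scalar_pair a_def)
  have "k l \<le> 1 \<and> unitarily_equiv 1 X (Y l) \<or> 1 < k l \<and>
      (\<exists>Z \<in> spin_disk (k l - 1). unitarily_equiv (k l) (Y l) (direct_sum_pair 1 (k l - 1) X Z))"
    if YV: "\<forall>l<N. Y l \<in> spin_disk (k l) \<and> V l \<in> carrier_mat (k l) 1 \<and> V l \<noteq> 0\<^sub>m (k l) 1"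
      and unity: "mat_sum 1 (\<lambda>l. mat_adjoint (V l) * V l) N = 1\<^sub>m 1"
      and sum: "X = (mat_sum 1 (\<lambda>l. fst (compress (V l) (Y l))) N,
        mat_sum 1 (\<lambda>l. snd (compress (V l) (Y l))) N)"
      and l: "l < N"
    for N l and k :: "nat \<Rightarrow> nat" and Y V
  proof -
    define v where "v = (\<lambda>l. col (V l) 0)"
    have Yh: "Y l \<in> hermitian_pairs (k l)" "contraction_mat (k l) (to_op (Y l))"
      and V: "V l \<in> carrier_mat (k l) 1" if "l < N" for l
      using that YV by (auto simp: spin_disk_iff_contraction)
    have v: "v l \<in> carrier_vec (k l)" if "l < N" for l
      unfolding v_def by (rule col_carrier_vec[OF _ V[OF that]]) simp
    have form: "(mat_adjoint (V l) * M * V l) $$ (0, 0) = (M *\<^sub>v v l) \<bullet>c v l"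
      if "l < N" "M \<in> carrier_mat (k l) (k l)" for l and M
    proof -
      have "mat_adjoint (V l) * M * V l = mat_adjoint (V l) * (M * V l)"
        using that V[OF that(1)] by (intro mult_mat_assoc) auto
      also have "\<dots> $$ (0, 0) = col (M * V l) 0 \<bullet>c v l"
        unfolding v_def using that V[OF that(1)] by (intro index_mat_adjoint_mult) auto
      also have "col (M * V l) 0 = M *\<^sub>v v l"
        unfolding v_def using that V[OF that(1)] by (intro col_mult2) auto
      finally show ?thesis .
    qed
    define b where "b = (\<lambda>l. (to_op (Y l) *\<^sub>v v l) \<bullet>c v l)"
    have "(\<Sum>l<N. complex_of_real (vec_sq (v l))) = 1"
    proof -
      have "(\<Sum>l<N. (mat_adjoint (V l) * V l) $$ (0, 0)) = 1"
        using arg_cong[OF unity, of "\<lambda>M. M $$ (0, 0)"] by (simp add: mat_sum_def)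
      moreover have "(mat_adjoint (V l) * V l) $$ (0, 0) = complex_of_real (vec_sq (v l))" if "l < N" for l
        using V[OF that] by (simp add: index_mat_adjoint_mult v_def cscalar_prod_self del: index_mult_mat(1))
      ultimately show ?thesis
        by simp
    qed
    then have sumv: "(\<Sum>l<N. vec_sq (v l)) = 1"
      by (metis of_real_eq_1_iff of_real_sum)
    have "(\<Sum>l<N. b l) = a"
    proof -
      have "b l = (fst (compress (V l) (Y l))) $$ (0, 0) + \<i> * (snd (compress (V l) (Y l))) $$ (0, 0)"
        if "l < N" for l
      proof -
        note Yd = hermitian_pairsD[OF Yh(1)[OF that]]
        have "b l = (fst (Y l) *\<^sub>v v l) \<bullet>c v l + \<i> * ((snd (Y l) *\<^sub>v v l) \<bullet>c v l)"
          unfolding b_def to_op_def using Yd v[OF that] by (simp add: mult_mat_vec_simps cscalar_prod_simps)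
        then show ?thesis
          using form[OF that Yd(2)] form[OF that Yd(3)] by (simp add: compress_def)
      qed
      then have "(\<Sum>l<N. b l) = (\<Sum>l<N. fst (compress (V l) (Y l)) $$ (0, 0))
          + \<i> * (\<Sum>l<N. snd (compress (V l) (Y l)) $$ (0, 0))"
        by (simp add: sum.distrib sum_distrib_left)
      also have "\<dots> = fst X $$ (0, 0) + \<i> * snd X $$ (0, 0)"
        by (subst (1 2) sum) (simp add: mat_sum_def)
      also have "\<dots> = a"
        by (simp add: X_def scalar_pair_def a_def complex_eq_iff)
      finally show ?thesis .
    qed
    then have "(\<Sum>l<N. Re (cnj a * b l)) = Re (cnj a * a)"
      by (simp only: Re_sum[symmetric] sum_distrib_left[symmetric])
    also have "cnj a * a = 1"
      using a complex_norm_square[of a] by (simp add: mult.commute)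
    \<comment> \<open>The gaps between the weights and the rotated form values are nonnegative and
      sum to 1 - 1 = 0, so each of them vanishes.\<close>
    finally have "(\<Sum>l<N. vec_sq (v l) - Re (cnj a * b l)) = 0"
      using sumv by (simp add: sum_subtractf)
    moreover have "0 \<le> vec_sq (v l) - Re (cnj a * b l)" if "l < N" for l
      using contraction_eigenvector(1)[OF Yh(2)[OF that] v[OF that] a] by (simp only: b_def diff_ge_0_iff_ge)
    ultimately have "vec_sq (v l) - Re (cnj a * b l) = 0"
      using l by (subst (asm) sum_nonneg_eq_0_iff) auto
    then have eq: "to_op (Y l) *\<^sub>v v l = a \<cdot>\<^sub>v v l"
      using contraction_eigenvector(2)[OF Yh(2)[OF l] v[OF l] a] by (simp only: b_def diff_eq_eq add_0_left)
    define n where "n = k l"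
    define B where "B = to_op (Y l)"
    have Bc: "B \<in> carrier_mat n n"
      using Yh(1)[OF l] by (simp add: B_def n_def)
    have n: "0 < n"
      using hermitian_pairsD(1)[OF Yh(1)[OF l]] by (simp add: n_def)
    have v0: "vec_sq (v l) \<noteq> 0"
    proof
      assume "vec_sq (v l) = 0"
      then have z: "v l = 0\<^sub>v (k l)"
        using vec_sq_eq_0_iff[OF v[OF l]] by simp
      have "V l $$ (i, 0) = 0" if "i < k l" for i
        using arg_cong[OF z, of "\<lambda>x. x $ i"] that V[OF l] by (simp add: v_def)
      then have "V l = 0\<^sub>m (k l) 1"
        using V[OF l] by (intro eq_matI) auto
      then show False
        using YV l by blast
    qed
    define w where "w = complex_of_real (1 / sqrt (vec_sq (v l))) \<cdot>\<^sub>v v l"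
    have w: "w \<in> carrier_vec n" "vec_sq w = 1"
      using v0 v[OF l] by (auto simp: w_def n_def vec_sq_smult norm_divide power_divide)
    have Bw: "B *\<^sub>v w = a \<cdot>\<^sub>v w"
      using Bc v[OF l] eq by (simp add: w_def B_def mult_mat_smult_vec n_def smult_smult_assoc mult.commute)
    have Baw: "mat_adjoint B *\<^sub>v w = cnj a \<cdot>\<^sub>v w"
      using contraction_eigenvector_adjoint[OF _ w(1) a Bw] Yh(2)[OF l] by (simp add: B_def n_def)
    \<comment> \<open>The normalized eigenvector, seen as an isometry from dimension one, becomes
      the first column of the unitary \<open>U\<close>.\<close>
    define W where "W = mat n 1 (\<lambda>(i, j). w $ i)"
    have colW: "col W 0 = w"
      using w by (intro eq_vecI) (auto simp: W_def)
    have "isometry_mat n 1 W"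
      using colW w(2) by (auto simp: isometry_mat_iff_cols W_def cscalar_prod_self)
    with isometry_mat_extend[of 1 n W] n obtain U where U: "isometry_mat n n U"
      "\<forall>i<n. \<forall>j<1. U $$ (i, j) = W $$ (i, j)"
      by auto
    have Uc: "U \<in> carrier_mat n n"
      using U(1) by (simp add: isometry_mat_def)
    have colU: "col U 0 = w"
      using U(2) Uc w(1) n by (intro eq_vecI) (auto simp: W_def)
    have orth: "col U j \<bullet>c col U i = (if i = j then 1 else 0)" if "i < n" "j < n" for i j
      using U(1) that by (auto simp: isometry_mat_iff_cols)
    define T where "T = mat_adjoint U * B * U"
    have Tc: "T \<in> carrier_mat n n"
      using Uc Bc by (auto simp: T_def)
    have T: "T $$ (i, j) = (B *\<^sub>v col U j) \<bullet>c col U i" if "i < n" "j < n" for i j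
    proof -
      have "T = mat_adjoint U * (B * U)"
        unfolding T_def using Uc Bc by (intro mult_mat_assoc) auto
      also have "\<dots> $$ (i, j) = col (B * U) j \<bullet>c col U i"
        using that Uc Bc by (intro index_mat_adjoint_mult) auto
      also have "col (B * U) j = B *\<^sub>v col U j"
        using that Uc Bc by (intro col_mult2) auto
      finally show ?thesis .
    qed
    have T_col: "T $$ (i, 0) = (if i = 0 then a else 0)" if "i < n" for i
      using that n T[of i 0] orth[of i 0] Uc unfolding colU Bw
      by (simp add: w(1)[THEN carrier_vecD])
    \<comment> \<open>The first row needs the adjoint equation: moving \<open>B\<close> across the
      inner product lets its adjoint act on \<open>w\<close>.\<close>
    have T_row: "T $$ (0, j) = (if j = 0 then a else 0)" if "j < n" for j
    proof -
      have "T $$ (0, j) = (B *\<^sub>v col U j) \<bullet>c w"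
        using T[of 0 j] that n unfolding colU by simp
      also have "\<dots> = col U j \<bullet>c (cnj a \<cdot>\<^sub>v w)"
        using cscalar_prod_mult_mat_vec[OF Bc, of "col U j" w] Uc that w(1) Baw by simp
      also have "\<dots> = a * (col U j \<bullet>c w)"
        using Uc w(1) by (simp add: cscalar_prod_smult_right)
      also have "col U j \<bullet>c w = (if j = 0 then 1 else 0)"
        using orth[of 0 j] that n unfolding colU by auto
      finally show ?thesis
        by simp
    qed
    have Un: "unitary_mat n U"
      by (rule isometry_mat_unitary(3)[OF U(1)])
    have Yn: "Y l \<in> spin_disk n" "Y l \<in> hermitian_pairs n"
      using YV l Yh(1)[OF l] by (auto simp: n_def)
    have cUY: "compress U (Y l) \<in> spin_disk n" "compress U (Y l) \<in> hermitian_pairs n"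
      "to_op (compress U (Y l)) = T"
      using spin_disk_compress[OF Yn(1) U(1)] compress_hermitian[OF Yn(2) Uc n]
        to_op_compress[OF Yn(2) Uc] n by (simp_all add: T_def B_def)
    show ?thesis
    proof (cases "n = 1")
      case True
      have "T = mat 1 1 (\<lambda>_. a)"
        using Tc T_col[of 0] True by (intro eq_matI) auto
      then have XU: "compress U (Y l) = X"
        using cUY(2,3) X(2,3) True by (intro to_op_inject) auto
      \<comment> \<open>The first alternative asks for \<open>Y l\<close> as a conjugate of
        \<open>X\<close>, the opposite direction to the one just shown, hence the inverse of
        \<open>U\<close>.\<close>
      have "compress (mat_adjoint U) X = Y l"
      proof (rule to_op_inject)
        show "compress (mat_adjoint U) X \<in> hermitian_pairs n"
          using compress_hermitian[of X n "mat_adjoint U" n] X(2) Uc n True by simp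
        have "to_op (compress (mat_adjoint U) X) = U * (mat_adjoint U * B * U) * mat_adjoint U"
          using to_op_compress[of X n "mat_adjoint U" n] X(2) Uc True cUY(3) XU by (simp add: T_def)
        also have "\<dots> = (U * mat_adjoint U) * B * (U * mat_adjoint U)"
          using Uc Bc by (simp add: mult_mat_assoc)
        also have "\<dots> = B"
          using Un Bc by (simp add: unitary_mat_def)
        finally show "to_op (compress (mat_adjoint U) X) = to_op (Y l)"
          by (simp add: B_def)
      qed (rule Yn(2))
      moreover have "unitary_mat 1 (mat_adjoint U)"
        using isometry_mat_unitary(3)[OF isometry_mat_unitary(2)[OF U(1)]] True by simp
      ultimately have "unitarily_equiv 1 X (Y l)"
        unfolding unitarily_equiv_def using X(2) Yn(2) True by auto
      then show ?thesis
        using True by (simp add: n_def)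
    next
      case False
      define m where "m = n - 1"
      have m: "n = 1 + m" "0 < m"
        using False n by (auto simp: m_def)
      \<comment> \<open>The lower right block of \<open>T\<close>; the shift by one skips the row
        and column of the eigenvector, which contain only the diagonal entry
        \<open>a\<close>.\<close>
      define Z where "Z = of_op (mat m m (\<lambda>(i, j). T $$ (i + 1, j + 1)))"
      have Z: "Z \<in> hermitian_pairs m" "to_op Z = mat m m (\<lambda>(i, j). T $$ (i + 1, j + 1))"
        using m by (auto simp: Z_def of_op_hermitian to_op_of_op[of _ m])
      have T_sum: "to_op (direct_sum_pair 1 m X Z) = T"
        unfolding to_op_direct_sum_pair[OF X(2) Z(1)] X(3) Z(2)
      proof (intro eq_matI)
        fix i j assume "i < dim_row T" "j < dim_col T"
        then have "i < n" "j < n"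
          using Tc by auto
        then show "four_block_mat (mat 1 1 (\<lambda>_. a)) (0\<^sub>m 1 m) (0\<^sub>m m 1)
            (mat m m (\<lambda>(i, j). T $$ (i + 1, j + 1))) $$ (i, j) = T $$ (i, j)"
          using T_col[of i] T_row[of j] m by (cases i; cases j) auto
      qed (use Tc m in auto)
      have sumh: "direct_sum_pair 1 m X Z \<in> hermitian_pairs n"
        using direct_sum_pair_hermitian[OF X(2) Z(1)] m by simp
      have eqv: "compress U (Y l) = direct_sum_pair 1 m X Z"
        using cUY T_sum sumh by (intro to_op_inject) auto
      have "contraction_mat (1 + m) (four_block_mat (to_op X) (0\<^sub>m 1 m) (0\<^sub>m m 1) (to_op Z))"
        using cUY(1) T_sum cUY(3) m to_op_direct_sum_pair[OF X(2) Z(1)]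
        by (simp add: spin_disk_iff_contraction)
      then have "contraction_mat m (to_op Z)"
        using contraction_mat_direct_sum[OF to_op_carrier[OF X(2)] to_op_carrier[OF Z(1)]] by simp
      then have "Z \<in> spin_disk (k l - 1)"
        using Z(1) m by (simp add: spin_disk_iff_contraction flip: n_def)
      moreover have "unitarily_equiv (k l) (Y l) (direct_sum_pair 1 (k l - 1) X Z)"
        using Yn(2) sumh Un eqv m by (auto simp: unitarily_equiv_def simp flip: n_def)
      ultimately show ?thesis
        using m by (auto simp flip: n_def)
    qed
  qed
  then show ?thesis
    unfolding absolute_extreme_points_def X_def[symmetric] using X(1) by blast
qed

section \<open>Comparison with the Euclidean extreme points\<close>

theorem absolute_extreme_points_spin_disk:
  "(\<Union>n. absolute_extreme_points spin_disk n) =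
    scalar_pair ` {p. p extreme_point_of level_one spin_disk}"
  unfolding extreme_points_level_one_spin_disk
proof (intro equalityI subsetI)
  fix X assume "X \<in> (\<Union>n. absolute_extreme_points spin_disk n)"
  then obtain n where X: "X \<in> absolute_extreme_points spin_disk n"
    by blast
  then have n: "n = 1"
    by (rule absolute_extreme_point_level)
  have iso: "isometry_mat 1 1 (to_op X)"
    using absolute_extreme_point_isometry[OF X] n by simp
  have "X \<in> spin_disk 1"
    using X n by (simp add: absolute_extreme_points_def)
  then have Xh: "X \<in> hermitian_pairs 1"
    by (simp add: spin_disk_iff_contraction)
  let ?a = "to_op X $$ (0, 0)"
  have A: "to_op X = mat 1 1 (\<lambda>_. ?a)"
    using to_op_carrier[OF Xh] by (intro eq_matI) auto
  have "X = scalar_pair (Re ?a, Im ?a)"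
    using A by (intro to_op_inject[OF Xh scalar_pair_hermitian]) (simp add: to_op_scalar_pair)
  moreover have "cmod ?a = 1"
  proof -
    have "(mat_adjoint (to_op X) * to_op X) $$ (0, 0) = 1"
      using iso by (simp add: isometry_mat_def)
    then have "cnj ?a * ?a = 1"
      using to_op_carrier[OF Xh] by (simp add: scalar_prod_def)
    then show ?thesis
      by (metis complex_mod_mult_cnj mult.commute norm_one power2_eq_1_iff norm_ge_zero not_one_le_zero le_minus_one_simps(3))
  qed
  ultimately show "X \<in> scalar_pair ` sphere 0 1"
    by (intro image_eqI[of _ _ "(Re ?a, Im ?a)"]) (auto simp: norm_Pair cmod_def)
next
  fix X assume "X \<in> scalar_pair ` sphere 0 1"
  then have "X \<in> absolute_extreme_points spin_disk 1"
    using scalar_pair_absolute_extreme by auto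
  then show "X \<in> (\<Union>n. absolute_extreme_points spin_disk n)"
    by blast
qed

theorem proposition7p5:
  shows "(\<forall>n. \<forall>(X1, X2) \<in> hermitian_pairs n.
            (X1, X2) \<in> arveson_boundary spin_disk n \<longleftrightarrow>
              X1 * X2 = X2 * X1 \<and> 1\<^sub>m n - X1 ^\<^sub>m 2 - X2 ^\<^sub>m 2 = 0\<^sub>m n n) \<and>
         matrix_convex_hull (arveson_boundary spin_disk) = spin_disk \<and>
         (\<Union>n. absolute_extreme_points spin_disk n) =
           scalar_pair ` {p. p extreme_point_of level_one spin_disk}"
proof (intro conjI allI ballI)
  fix n X assume "X \<in> hermitian_pairs n"
  then show "case X of (X1, X2) \<Rightarrow> (X1, X2) \<in> arveson_boundary spin_disk n \<longleftrightarrow>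
      X1 * X2 = X2 * X1 \<and> 1\<^sub>m n - X1 ^\<^sub>m 2 - X2 ^\<^sub>m 2 = 0\<^sub>m n n"
    using arveson_boundary_spin_disk[of X n] isometry_to_op_iff[of X n] by (simp add: case_prod_beta)
qed (rule matrix_convex_hull_arveson_boundary absolute_extreme_points_spin_disk)+

end
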